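(* Let $W$ be a finite Coxeter group, $k$ a field whose characteristic does not divide $|W|$, $\mathcal F$ the face semigroup and $\mathcal L$ the intersection lattice of the reflection arrangement of $W$. For each $X\in\mathcal L$, fix a $k$-linear combination $\ell_X\in k\mathcal F$ of faces of support $X$ whose coefficients sum to $1$, and suppose that $w(\ell_X)=\ell_{w(X)}$ for all $w\in W$, $X\in\mathcal L$. Then the elements defined recursively by $$e_X=\ell_X-\sum_{Y>X}\ell_X e_Y,$$ one for each $X\in\mathcal L$, form a complete system of primitive orthogonal idempotents for $k\mathcal F$, and they satisfy $w(e_X)=e_{w(X)}$ for every $w\in W$ and $X\in\mathcal L$. The elements $$\varepsilon_{\mathcal O}=\sum_{X\in\mathcal O}e_X,$$ one for each $W$-orbit $\mathcal O\in\mathcal L/W$, form a complete system of primitive orthogonal idempotents for $(k\mathcal F)^W$.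
   Context: $W$ is a finite group of orthogonal transformations of a finite dimensional real inner product space $V$ generated by reflections. Its reflection arrangement $\mathcal A$ is the set of hyperplanes of $V$ fixed by some reflection in $W$. For each $H\in\mathcal A$ let $H^+,H^-$ be the two open half spaces determined by $H$ (labels fixed arbitrarily) and $H^0=H$. A face is a non-empty intersection $x=\bigcap_{H\in\mathcal A}H^{\sigma_H(x)}$ with $\sigma_H(x)\in\{+,0,-\}$. The set $\mathcal F$ of faces is a semigroup with identity: $xy$ is the face with $\sigma_H(xy)=\sigma_H(x)$ if $\sigma_H(x)\ne 0$ and $\sigma_H(xy)=\sigma_H(y)$ if $\sigma_H(x)=0$. $k\mathcal F$ is its semigroup algebra over $k$. The support $\operatorname{supp}(x)$ of a face $x$ is the intersection of all hyperplanes of $\mathcal A$ containing $x$ (equivalently the linear span of $x$). The intersection lattice is $\mathcal L=\operatorname{supp}(\mathcal F)$, ordered by inclusion of subspaces. $W$ acts on $\mathcal F$, on $\mathcal L$ and (by algebra automorphisms) on $k\mathcal F$; $(k\mathcal F)^W$ is the subalgebra of $W$-fixed elements; $\mathcal L/W$ is the set of $W$-orbits on $\mathcal L$. A complete system of primitive orthogonal idempotents of an algebra is a set of pairwise orthogonal primitive idempotents summing to $1$. *)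

theory Defs
  imports
    "HOL-Analysis.Linear_Algebra"
    "HOL-Algebra.Generated_Groups"
    "HOL-Algebra.Group_Action"
    "HOL-Algebra.Ring"
begin

definition orthogonal_group :: "('v::real_inner \<Rightarrow> 'v) monoid" where
  "orthogonal_group = \<lparr>carrier = {f. orthogonal_transformation f}, mult = (\<circ>), one = id\<rparr>"

definition is_reflection :: "('v::real_inner \<Rightarrow> 'v) \<Rightarrow> bool" where
  "is_reflection r \<longleftrightarrow> (\<exists>a. a \<noteq> 0 \<and> r = (\<lambda>v. v - (2 * (a \<bullet> v) / (a \<bullet> a)) *\<^sub>R a))"

definition finite_reflection_group :: "('v::real_inner \<Rightarrow> 'v) set \<Rightarrow> bool" where
  "finite_reflection_group W \<longleftrightarrow>
     finite W \<and> (\<exists>S. (\<forall>r\<in>S. is_reflection r) \<and> W = generate orthogonal_group S)"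

definition reflection_arrangement :: "('v::real_inner \<Rightarrow> 'v) set \<Rightarrow> 'v set set" where
  "reflection_arrangement W = {{v. r v = v} |r. r \<in> W \<and> is_reflection r}"

text \<open>The labelling of the two open half spaces of each hyperplane \<open>H\<close> is given by a choice
  \<open>\<nu> H\<close> of a normal vector of \<open>H\<close>, pointing into \<open>H\<^sup>+\<close>.\<close>

definition half_space_labelling :: "'v::real_inner set set \<Rightarrow> ('v set \<Rightarrow> 'v) \<Rightarrow> bool" where
  "half_space_labelling A \<nu> \<longleftrightarrow> (\<forall>H\<in>A. \<nu> H \<noteq> 0 \<and> H = {v. \<nu> H \<bullet> v = 0})"

datatype sign = Neg | Zero | Pos

fun region :: "('v::real_inner set \<Rightarrow> 'v) \<Rightarrow> 'v set \<Rightarrow> sign \<Rightarrow> 'v set" where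
  "region \<nu> H Pos = {v. \<nu> H \<bullet> v > 0}"
| "region \<nu> H Neg = {v. \<nu> H \<bullet> v < 0}"
| "region \<nu> H Zero = H"

definition faces :: "'v::real_inner set set \<Rightarrow> ('v set \<Rightarrow> 'v) \<Rightarrow> 'v set set" where
  "faces A \<nu> = {x. x \<noteq> {} \<and> (\<exists>\<sigma>. x = (\<Inter>H\<in>A. region \<nu> H (\<sigma> H)))}"

definition face_sign :: "('v::real_inner set \<Rightarrow> 'v) \<Rightarrow> 'v set \<Rightarrow> 'v set \<Rightarrow> sign" where
  "face_sign \<nu> x H = (THE s. x \<subseteq> region \<nu> H s)"

definition face_mult ::
  "'v::real_inner set set \<Rightarrow> ('v set \<Rightarrow> 'v) \<Rightarrow> 'v set \<Rightarrow> 'v set \<Rightarrow> 'v set" where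
  "face_mult A \<nu> x y =
     (\<Inter>H\<in>A. region \<nu> H
        (if face_sign \<nu> x H \<noteq> Zero then face_sign \<nu> x H else face_sign \<nu> y H))"

definition supp :: "'v set set \<Rightarrow> 'v set \<Rightarrow> 'v set" where
  "supp A x = \<Inter>{H \<in> A. x \<subseteq> H}"

definition intersection_lattice ::
  "'v::real_inner set set \<Rightarrow> ('v set \<Rightarrow> 'v) \<Rightarrow> 'v set set" where
  "intersection_lattice A \<nu> = supp A ` faces A \<nu>"

text \<open>An element of the semigroup algebra is the function sending a face to its coefficient,
  extended by zero to sets that are not faces. The unit is the face \<open>\<Inter>A\<close>, whose signs are all
  zero.\<close>

definition face_algebra ::
  "'v::real_inner set set \<Rightarrow> ('v set \<Rightarrow> 'v) \<Rightarrow> ('v set \<Rightarrow> 'k::field) ring" where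
  "face_algebra A \<nu> =
     \<lparr>carrier = {a. \<forall>x. x \<notin> faces A \<nu> \<longrightarrow> a x = 0},
      mult = (\<lambda>a b z. \<Sum>x\<in>faces A \<nu>. \<Sum>y\<in>{y \<in> faces A \<nu>. face_mult A \<nu> x y = z}. a x * b y),
      one = (\<lambda>x. if x = \<Inter>A then 1 else 0),
      zero = (\<lambda>x. 0),
      add = (\<lambda>a b x. a x + b x)\<rparr>"

text \<open>For a bijection \<open>w\<close>, the preimage \<open>w -` x\<close> is \<open>w\<inverse>(x)\<close>; so this is the linear extension of
  the action \<open>x \<mapsto> w(x)\<close> on faces.\<close>

definition algebra_act :: "('v \<Rightarrow> 'v) \<Rightarrow> ('v set \<Rightarrow> 'k) \<Rightarrow> 'v set \<Rightarrow> 'k" where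
  "algebra_act w a = (\<lambda>x. a (w -` x))"

definition invariant_algebra ::
  "('v::real_inner \<Rightarrow> 'v) set \<Rightarrow> 'v set set \<Rightarrow> ('v set \<Rightarrow> 'v) \<Rightarrow> ('v set \<Rightarrow> 'k::field) ring" where
  "invariant_algebra W A \<nu> = (face_algebra A \<nu>)
     \<lparr>carrier := {a \<in> carrier (face_algebra A \<nu>). \<forall>w\<in>W. algebra_act w a = a}\<rparr>"

definition primitive_idempotent :: "('a, 'b) ring_scheme \<Rightarrow> 'a \<Rightarrow> bool" where
  "primitive_idempotent R e \<longleftrightarrow>
     e \<in> carrier R \<and> e \<otimes>\<^bsub>R\<^esub> e = e \<and> e \<noteq> \<zero>\<^bsub>R\<^esub> \<and>
     (\<forall>f\<in>carrier R. \<forall>g\<in>carrier R.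
        f \<otimes>\<^bsub>R\<^esub> f = f \<and> g \<otimes>\<^bsub>R\<^esub> g = g \<and> f \<otimes>\<^bsub>R\<^esub> g = \<zero>\<^bsub>R\<^esub> \<and> g \<otimes>\<^bsub>R\<^esub> f = \<zero>\<^bsub>R\<^esub> \<and> e = f \<oplus>\<^bsub>R\<^esub> g
        \<longrightarrow> f = \<zero>\<^bsub>R\<^esub> \<or> g = \<zero>\<^bsub>R\<^esub>)"

definition complete_primitive_orthogonal_idempotents ::
  "('a, 'b) ring_scheme \<Rightarrow> 'i set \<Rightarrow> ('i \<Rightarrow> 'a) \<Rightarrow> bool" where
  "complete_primitive_orthogonal_idempotents R I e \<longleftrightarrow>
     finite I \<and>
     (\<forall>i\<in>I. primitive_idempotent R (e i)) \<and>
     (\<forall>i\<in>I. \<forall>j\<in>I. i \<noteq> j \<longrightarrow> e i \<otimes>\<^bsub>R\<^esub> e j = \<zero>\<^bsub>R\<^esub>) \<and>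
     (\<Oplus>\<^bsub>R\<^esub>i\<in>I. e i) = \<one>\<^bsub>R\<^esub>"

definition support_section ::
  "'v::real_inner set set \<Rightarrow> ('v set \<Rightarrow> 'v) \<Rightarrow> 'v set \<Rightarrow> ('v set \<Rightarrow> 'k::field) \<Rightarrow> bool" where
  "support_section A \<nu> X l \<longleftrightarrow>
     (\<forall>x. l x \<noteq> 0 \<longrightarrow> x \<in> faces A \<nu> \<and> supp A x = X) \<and> (\<Sum>x\<in>faces A \<nu>. l x) = 1"

text \<open>The finiteness test only serves termination: the intersection lattice of a finite
  arrangement is finite.\<close>

function face_idempotent ::
  "'v::real_inner set set \<Rightarrow> ('v set \<Rightarrow> 'v) \<Rightarrow> ('v set \<Rightarrow> 'v set \<Rightarrow> 'k::field) \<Rightarrow>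
   'v set \<Rightarrow> 'v set \<Rightarrow> 'k" where
  "face_idempotent A \<nu> l X =
     (if finite (intersection_lattice A \<nu>)
      then (\<lambda>x. l X x -
              (\<Sum>Y\<in>{Y \<in> intersection_lattice A \<nu>. X \<subset> Y}.
                 (l X \<otimes>\<^bsub>face_algebra A \<nu>\<^esub> face_idempotent A \<nu> l Y) x))
      else (\<lambda>x. 0))"
  by pat_completeness auto
termination
  by (relation "measure (\<lambda>(A, \<nu>, l, X). card {Y \<in> intersection_lattice A \<nu>. X \<subset> Y})")
    (auto intro!: psubset_card_mono)

declare face_idempotent.simps [simp del]

end

(* With chi_X(a) the sum of the coefficients of a at the faces of support at most X, the idempotents
   satisfy e_X a e_X = chi_X(a) e_X, and e_X a e_Y = 0 unless X is contained in Y: faces whose support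
   is not contained in X annihilate e_X from the left, and the others are absorbed by e_X from the
   right. This makes every e_X primitive. Members of a W-orbit are pairwise incomparable and chi_X(a)
   depends only on the orbit of X when a is W-invariant, so eps a eps is a scalar multiple of eps for
   the sum eps of the e_X over an orbit, and eps is primitive among the invariants. *)

theory Submission
  imports Defs "HOL-Library.Function_Algebras"
begin

text \<open>Why a face y whose support is not inside X annihilates e_X: the element y l_X combines
  faces of a single support Z, the join of supp(y) and X, and Z lies strictly above X. The recursion
  gives y e_X as y l_X minus the sum of y l_X e_Y over Y > X. By downward induction only the Y above
  or equal to Z contribute, and since l_Z is a right unit for everything supported above Z and is
  the sum of the l_Z e_Y, those terms add up to y l_X. So the difference is 0. This is an argument
  about left regular bands, with supports in an abstract order. Geometry enters through points of
  faces. A product of faces is non-empty because a small step from a point of the first in the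
  direction of a point of the second realises the product signs. A symmetry may exchange the
  arbitrarily labelled half spaces, but reversing both signs commutes with composing them, so
  products are respected.\<close>

section \<open>Left regular bands\<close>

text \<open>As simplification rules the pointwise laws would rewrite inside eta-expanded occurrences of
  sums of functions, leaving terms such as \<open>\<lambda>x. 0\<close> in place of \<open>0\<close>.\<close>

declare plus_fun_apply [simp del] zero_fun_apply [simp del] minus_apply [simp del]

lemma sum_fun_apply: "(\<Sum>i\<in>I. f i) x = (\<Sum>i\<in>I. f i x)"
  by (induction I rule: infinite_finite_induct) (simp_all add: zero_fun_apply plus_fun_apply)

lemmas fun_apply = plus_fun_apply zero_fun_apply minus_apply sum_fun_apply

text \<open>Has the shape of the product of \<open>face_algebra\<close>, with the set of faces and
  their product as parameters. Coefficients of the factors outside \<open>F\<close> never enter, so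
  bilinearity holds for arbitrary functions.\<close>

definition conv :: "'a set \<Rightarrow> ('a \<Rightarrow> 'a \<Rightarrow> 'a) \<Rightarrow> ('a \<Rightarrow> 'k::field) \<Rightarrow> ('a \<Rightarrow> 'k) \<Rightarrow> 'a \<Rightarrow> 'k" where
  "conv F m a b = (\<lambda>z. \<Sum>x\<in>F. \<Sum>y\<in>{y \<in> F. m x y = z}. a x * b y)"

lemma conv_add_left: "conv F m (a + a') b = conv F m a b + conv F m a' b"
  by (simp add: conv_def fun_eq_iff fun_apply sum.distrib algebra_simps)

lemma conv_add_right: "conv F m a (b + b') = conv F m a b + conv F m a b'"
  by (simp add: conv_def fun_eq_iff fun_apply sum.distrib algebra_simps)

lemma conv_diff_left: "conv F m (a - a') b = conv F m a b - conv F m a' b"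
  by (simp add: conv_def fun_eq_iff fun_apply sum_subtractf algebra_simps)

lemma conv_diff_right: "conv F m a (b - b') = conv F m a b - conv F m a b'"
  by (simp add: conv_def fun_eq_iff fun_apply sum_subtractf algebra_simps)

lemma conv_zero_left [simp]: "conv F m 0 b = 0"
  by (simp add: conv_def fun_eq_iff fun_apply)

lemma conv_zero_right [simp]: "conv F m a 0 = 0"
  by (simp add: conv_def fun_eq_iff fun_apply)

lemma conv_sum_left: "conv F m (\<Sum>i\<in>I. a i) b = (\<Sum>i\<in>I. conv F m (a i) b)"
  by (induction I rule: infinite_finite_induct) (simp_all add: conv_add_left)

lemma conv_sum_right: "conv F m a (\<Sum>i\<in>I. b i) = (\<Sum>i\<in>I. conv F m a (b i))"
  by (induction I rule: infinite_finite_induct) (simp_all add: conv_add_right)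

lemma conv_scale_left: "conv F m (\<lambda>x. c * a x) b = (\<lambda>x. c * conv F m a b x)"
  by (simp add: conv_def fun_eq_iff fun_apply sum_distrib_left algebra_simps)

lemma conv_scale_right: "conv F m a (\<lambda>x. c * b x) = (\<lambda>x. c * conv F m a b x)"
  by (simp add: conv_def fun_eq_iff fun_apply sum_distrib_left algebra_simps)

lemma conv_nonzeroE:
  assumes "conv F m a b z \<noteq> 0"
  obtains x y where "x \<in> F" "y \<in> F" "a x \<noteq> 0" "b y \<noteq> 0" "z = m x y"
proof -
  obtain x where x: "x \<in> F" "(\<Sum>y\<in>{y \<in> F. m x y = z}. a x * b y) \<noteq> 0"
    using assms unfolding conv_def by (meson sum.not_neutral_contains_not_neutral)
  then obtain y where "y \<in> {y \<in> F. m x y = z}" "a x * b y \<noteq> 0"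
    by (meson sum.not_neutral_contains_not_neutral)
  with x that show thesis by auto
qed

text \<open>The last axiom makes the order on supports the absorption order: an element of smaller
  support disappears when multiplied on the right. For faces this is inclusion of subspaces, so the
  unit has the least support.\<close>

locale left_regular_band =
  fixes F :: "'a set" and m :: "'a \<Rightarrow> 'a \<Rightarrow> 'a" and u :: 'a and s :: "'a \<Rightarrow> 'b::order"
  assumes finite_F [simp]: "finite F"
    and closed [simp]: "x \<in> F \<Longrightarrow> y \<in> F \<Longrightarrow> m x y \<in> F"
    and assoc: "x \<in> F \<Longrightarrow> y \<in> F \<Longrightarrow> z \<in> F \<Longrightarrow> m (m x y) z = m x (m y z)"
    and unit_closed [simp]: "u \<in> F"
    and unit_left [simp]: "x \<in> F \<Longrightarrow> m u x = x"
    and unit_right [simp]: "x \<in> F \<Longrightarrow> m x u = x"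
    and left_regular: "x \<in> F \<Longrightarrow> y \<in> F \<Longrightarrow> m (m x y) x = m x y"
    and support_le_iff: "x \<in> F \<Longrightarrow> y \<in> F \<Longrightarrow> s x \<le> s y \<longleftrightarrow> m y x = y"
begin

abbreviation cv :: "('a \<Rightarrow> 'k::field) \<Rightarrow> ('a \<Rightarrow> 'k) \<Rightarrow> 'a \<Rightarrow> 'k" (infixl "\<star>" 70) where
  "a \<star> b \<equiv> conv F m a b"

abbreviation single :: "'a \<Rightarrow> 'a \<Rightarrow> 'k::field" where
  "single y \<equiv> \<lambda>x. if x = y then 1 else 0"

lemma support_le_left: "x \<in> F \<Longrightarrow> y \<in> F \<Longrightarrow> s x \<le> s (m x y)"
  by (simp add: support_le_iff left_regular)

lemma idem: "x \<in> F \<Longrightarrow> m x x = x"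
  using support_le_iff by blast

lemma support_le_right: "x \<in> F \<Longrightarrow> y \<in> F \<Longrightarrow> s y \<le> s (m x y)"
  by (simp add: support_le_iff assoc idem)

text \<open>Together with \<open>support_le_left\<close> and \<open>support_le_right\<close> this
  makes \<open>s (m x y)\<close> the join of \<open>s x\<close> and \<open>s y\<close> in the image
  of \<open>s\<close>: an element of support \<open>Z\<close> absorbs \<open>x\<close> and then
  \<open>y\<close>, hence their product.\<close>

lemma support_least:
  "x \<in> F \<Longrightarrow> y \<in> F \<Longrightarrow> Z \<in> s ` F \<Longrightarrow> s x \<le> Z \<Longrightarrow> s y \<le> Z \<Longrightarrow> s (m x y) \<le> Z"
  by (auto simp: support_le_iff simp flip: assoc)

text \<open>Change of variables along \<open>m\<close>: summing a product against a test function
  \<open>g\<close> removes the sum over fibres. Associativity follows by using it once for each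
  bracketing.\<close>

lemma conv_sum_pairing:
  "(\<Sum>z\<in>F. (a \<star> b) z * g z) = (\<Sum>x\<in>F. \<Sum>y\<in>F. a x * b y * g (m x y))"
proof -
  have "(\<Sum>z\<in>F. (a \<star> b) z * g z)
      = (\<Sum>z\<in>F. \<Sum>x\<in>F. \<Sum>y\<in>{y \<in> F. m x y = z}. a x * b y * g (m x y))"
    by (simp add: conv_def sum_distrib_right)
  also have "\<dots> = (\<Sum>x\<in>F. \<Sum>z\<in>F. \<Sum>y\<in>{y \<in> F. m x y = z}. a x * b y * g (m x y))"
    by (rule sum.swap)
  also have "\<dots> = (\<Sum>x\<in>F. \<Sum>y\<in>F. a x * b y * g (m x y))"
    by (intro sum.cong refl sum.group) auto
  finally show ?thesis .
qed

lemma conv_alt: "(a \<star> b) z = (\<Sum>x\<in>F. \<Sum>y\<in>F. a x * b y * (if m x y = z then 1 else 0))"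
  by (auto simp: conv_def sum.inter_filter intro!: sum.cong)

lemma conv_assoc: "(a \<star> b) \<star> c = a \<star> (b \<star> c)"
proof
  fix z
  have "((a \<star> b) \<star> c) z
      = (\<Sum>w\<in>F. (a \<star> b) w * (\<Sum>t\<in>F. c t * (if m w t = z then 1 else 0)))"
    by (simp add: conv_alt[of _ c] sum_distrib_left mult.assoc)
  also have "\<dots> = (\<Sum>x\<in>F. \<Sum>y\<in>F. a x * b y * (\<Sum>t\<in>F. c t * (if m (m x y) t = z then 1 else 0)))"
    by (rule conv_sum_pairing)
  also have "\<dots> = (\<Sum>x\<in>F. a x * (\<Sum>y\<in>F. \<Sum>t\<in>F. b y * c t * (if m x (m y t) = z then 1 else 0)))"
    by (simp add: sum_distrib_left assoc mult.assoc)
  also have "\<dots> = (\<Sum>x\<in>F. a x * (\<Sum>w\<in>F. (b \<star> c) w * (if m x w = z then 1 else 0)))"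
    by (simp only: conv_sum_pairing)
  also have "\<dots> = (a \<star> (b \<star> c)) z"
    by (simp add: conv_alt[of a] sum_distrib_left mult.assoc)
  finally show "((a \<star> b) \<star> c) z = (a \<star> (b \<star> c)) z" .
qed

text \<open>Wherever both coefficients are non-zero, \<open>s y \<le> X \<le> s x\<close> and so
  \<open>m x y = x\<close>. With coefficient sum 1 this makes \<open>l X\<close> a right unit; with
  an arbitrary sum it produces the scalar of \<open>e_conv_e_sandwich\<close>.\<close>

lemma conv_absorb:
  assumes a: "\<And>x. a x \<noteq> 0 \<Longrightarrow> x \<in> F \<and> X \<le> s x"
    and b: "\<And>y. y \<in> F \<Longrightarrow> b y \<noteq> 0 \<Longrightarrow> s y \<le> X"
  shows "a \<star> b = (\<lambda>z. (\<Sum>y\<in>F. b y) * a z)"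
proof
  fix z
  have "(a \<star> b) z = (\<Sum>x\<in>F. \<Sum>y\<in>F. a x * b y * (if x = z then 1 else 0))"
    unfolding conv_alt
  proof (intro sum.cong refl)
    fix x y assume "x \<in> F" "y \<in> F"
    moreover have "m x y = x" if "a x \<noteq> 0" "b y \<noteq> 0"
      using that a b \<open>x \<in> F\<close> \<open>y \<in> F\<close> support_le_iff by (meson order_trans)
    ultimately show "a x * b y * (if m x y = z then 1 else 0)
        = a x * b y * (if x = z then 1 else 0)"
      by (cases "a x = 0 \<or> b y = 0") auto
  qed
  also have "\<dots> = (\<Sum>x\<in>F. if x = z then (\<Sum>y\<in>F. b y) * a x else 0)"
    by (intro sum.cong refl) (auto simp: sum_distrib_left mult.commute)
  also have "\<dots> = (\<Sum>y\<in>F. b y) * a z"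
    using a[of z] by auto
  finally show "(a \<star> b) z = (\<Sum>y\<in>F. b y) * a z" .
qed

lemma conv_expand_left: "(a \<star> b) z = (\<Sum>y\<in>F. a y * (single y \<star> b) z)"
proof -
  have "(single y \<star> b) z = (\<Sum>t\<in>F. b t * (if m y t = z then 1 else 0))" if "y \<in> F" for y
  proof -
    have "(single y \<star> b) z
        = (\<Sum>x\<in>F. if x = y then \<Sum>t\<in>F. b t * (if m y t = z then 1 else 0) else 0)"
      unfolding conv_alt by (intro sum.cong refl) auto
    with that show ?thesis by simp
  qed
  then show ?thesis
    by (simp add: conv_alt[of a] sum_distrib_left mult.assoc)
qed

lemma conv_unit_left:
  assumes "\<And>x. a x \<noteq> 0 \<Longrightarrow> x \<in> F"
  shows "single u \<star> a = a"
proof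
  fix z
  have "(single u \<star> a) z
      = (\<Sum>x\<in>F. if x = u then \<Sum>y\<in>F. a y * (if m u y = z then 1 else 0) else 0)"
    unfolding conv_alt by (intro sum.cong refl) auto
  also have "\<dots> = (\<Sum>y\<in>F. if y = z then a y else 0)"
  proof -
    have "(\<Sum>y\<in>F. a y * (if m u y = z then 1 else 0)) = (\<Sum>y\<in>F. if y = z then a y else 0)"
      by (intro sum.cong) auto
    then show ?thesis by simp
  qed
  also have "\<dots> = a z" using assms[of z] by auto
  finally show "(single u \<star> a) z = a z" .
qed

end

section \<open>Idempotents built from sections of the support map\<close>

locale band_idempotents = left_regular_band F m u s
  for F :: "'a set" and m u and s :: "'a \<Rightarrow> 'b::order" +
  fixes l e :: "'b \<Rightarrow> 'a \<Rightarrow> 'k::field"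
  assumes l_nonzero: "X \<in> s ` F \<Longrightarrow> l X x \<noteq> 0 \<Longrightarrow> x \<in> F \<and> s x = X"
    and l_sum: "X \<in> s ` F \<Longrightarrow> (\<Sum>x\<in>F. l X x) = 1"
    and e_rec: "X \<in> s ` F \<Longrightarrow> e X = l X - (\<Sum>Y\<in>{Y \<in> s ` F. X < Y}. l X \<star> e Y)"
begin

abbreviation L :: "'b set" where "L \<equiv> s ` F"

lemma finite_L [simp]: "finite L"
  by simp

text \<open>The recursion for \<open>e X\<close> refers only to larger \<open>Y\<close>, so
  inductions start at the top of the finite set \<open>L\<close>, measured by the number of elements
  strictly above.\<close>

lemma downward_induct [consumes 1, case_names step]:
  assumes "X \<in> L" and step: "\<And>X. X \<in> L \<Longrightarrow> (\<And>Y. Y \<in> L \<Longrightarrow> X < Y \<Longrightarrow> P Y) \<Longrightarrow> P X"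
  shows "P X"
  using assms(1)
proof (induction "card {Y \<in> L. X < Y}" arbitrary: X rule: less_induct)
  case less
  show ?case
  proof (rule step[OF less.prems])
    fix Y assume Y: "Y \<in> L" "X < Y"
    then have "{Z \<in> L. Y < Z} \<subset> {Z \<in> L. X < Z}" by auto
    with Y show "P Y" by (intro less.hyps psubset_card_mono) auto
  qed
qed

text \<open>Every term of the recursion starts with an element of support \<open>X\<close>, and
  multiplication on the right can only raise the support.\<close>

lemma e_nonzero:
  assumes "X \<in> L" "e X x \<noteq> 0"
  shows "x \<in> F \<and> X \<le> s x"
proof (cases "l X x = 0")
  case True
  then have "(\<Sum>Y\<in>{Y \<in> L. X < Y}. (l X \<star> e Y) x) \<noteq> 0"
    using assms e_rec[of X] by (auto simp: fun_apply)
  then obtain Y where "(l X \<star> e Y) x \<noteq> 0"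
    by (meson sum.not_neutral_contains_not_neutral)
  then obtain y z where "y \<in> F" "z \<in> F" "l X y \<noteq> 0" "x = m y z"
    by (rule conv_nonzeroE)
  with l_nonzero[OF assms(1)] show ?thesis
    using support_le_left by fastforce
next
  case False
  with l_nonzero[OF assms(1)] show ?thesis by fastforce
qed

lemma conv_l:
  assumes "X \<in> L" "\<And>x. a x \<noteq> 0 \<Longrightarrow> x \<in> F \<and> X \<le> s x"
  shows "a \<star> l X = a"
  using conv_absorb[of a X "l X"] assms l_nonzero[OF assms(1)] l_sum[OF assms(1)] by auto

text \<open>\<open>l X\<close> is idempotent, and each term of the recursion has \<open>l X\<close>
  as its left factor.\<close>

lemma l_conv_e:
  assumes X: "X \<in> L"
  shows "l X \<star> e X = e X"
proof -
  have l: "l X \<star> l X = l X"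
    by (rule conv_l[OF X]) (use l_nonzero[OF X] in auto)
  have "l X \<star> e X = l X \<star> l X - (\<Sum>Y\<in>{Y \<in> L. X < Y}. (l X \<star> l X) \<star> e Y)"
    by (simp only: e_rec[OF X] conv_diff_right conv_sum_right conv_assoc)
  then show ?thesis
    unfolding l e_rec[OF X, symmetric] .
qed

lemma l_expand: "X \<in> L \<Longrightarrow> l X = (\<Sum>Y\<in>{Y \<in> L. X \<le> Y}. l X \<star> e Y)"
proof -
  assume X: "X \<in> L"
  then have "{Y \<in> L. X \<le> Y} = insert X {Y \<in> L. X < Y}" by auto
  then show ?thesis
    using e_rec[OF X] l_conv_e[OF X] by (simp add: algebra_simps)
qed

text \<open>\<open>l X\<close> is a right unit for \<open>a\<close>, so its expansion can be
  multiplied by \<open>a\<close> from the left. At the least support this becomes the completeness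
  relation \<open>e_sum\<close>.\<close>

lemma expand:
  assumes "X \<in> L" "\<And>x. a x \<noteq> 0 \<Longrightarrow> x \<in> F \<and> X \<le> s x"
  shows "a = (\<Sum>Y\<in>{Y \<in> L. X \<le> Y}. a \<star> e Y)"
proof -
  have "a = a \<star> l X" using conv_l[OF assms] by simp
  also have "\<dots> = (\<Sum>Y\<in>{Y \<in> L. X \<le> Y}. a \<star> e Y)"
    by (subst l_expand[OF assms(1)]) (simp add: conv_sum_right conv_l[OF assms] flip: conv_assoc)
  finally show ?thesis .
qed

text \<open>Stated for arbitrary \<open>a\<close> because the induction hypothesis is needed for
  another left factor, the product of a single element with \<open>l X\<close>.\<close>

lemma conv_e_eq_0:
  assumes "X \<in> L" "\<And>y. y \<in> F \<Longrightarrow> a y \<noteq> 0 \<Longrightarrow> \<not> s y \<le> X"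
  shows "a \<star> e X = 0"
  using assms
proof (induction arbitrary: a rule: downward_induct)
  case (step X)
  have single: "single y \<star> e X = 0" if y: "y \<in> F" "\<not> s y \<le> X" for y
  proof -
    \<comment> \<open>The choice of \<open>z\<close> is immaterial: it only serves to exhibit the
      join of \<open>s y\<close> and \<open>X\<close> as an element of \<open>L\<close>.\<close>
    obtain z where z: "z \<in> F" "X = s z" using step.hyps by auto
    define Z where "Z = s (m y z)"
    have Z: "Z \<in> L" "X < Z" "s y \<le> Z"
      using y z support_le_left[of y z] support_le_right[of y z]
      by (auto simp: Z_def less_le_not_le intro: order_trans)
    define b where "b = single y \<star> l X"
    have b: "x \<in> F \<and> s x = Z" if "b x \<noteq> 0" for x
    proof -
      obtain t where t: "t \<in> F" "l X t \<noteq> 0" "x = m y t"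
        using \<open>b x \<noteq> 0\<close> unfolding b_def by (elim conv_nonzeroE) (auto split: if_splits)
      then have "s t = X" using l_nonzero[OF step.hyps, of t] by simp
      \<comment> \<open>\<open>t\<close> and \<open>z\<close> have the same support
        \<open>X\<close>, so \<open>m y t\<close> and \<open>m y z\<close> are both joins of
        \<open>s y\<close> and \<open>X\<close> and bound each other.\<close>
      then have "X \<le> s x" "s y \<le> s x" "X \<le> Z" "s t \<le> Z"
        using t y Z support_le_left[of y t] support_le_right[of y t] by auto
      then have "s x \<le> Z" "Z \<le> s x"
        using t y z Z support_least[of y t Z] support_least[of y z "s x"]
        by (auto simp: Z_def)
      with t y show ?thesis by auto
    qed
    have "single y \<star> e X = b - (\<Sum>Y\<in>{Y \<in> L. X < Y}. b \<star> e Y)"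
      unfolding e_rec[OF step.hyps] b_def
      by (simp add: conv_diff_right conv_sum_right flip: conv_assoc)
    \<comment> \<open>For \<open>Y\<close> above \<open>X\<close> but not above \<open>Z\<close> the
      induction hypothesis applies to \<open>b\<close>, whose support is \<open>Z\<close>. What is
      left is the range of \<open>expand\<close> at \<open>Z\<close>.\<close>
    also have "(\<Sum>Y\<in>{Y \<in> L. X < Y}. b \<star> e Y) = (\<Sum>Y\<in>{Y \<in> L. Z \<le> Y}. b \<star> e Y)"
    proof (rule sum.mono_neutral_right)
      show "\<forall>Y\<in>{Y \<in> L. X < Y} - {Y \<in> L. Z \<le> Y}. b \<star> e Y = 0"
        using b by (auto intro!: step.IH)
    qed (use Z in auto)
    also have "\<dots> = b"
      using expand[of Z b] b Z by simp
    finally show ?thesis by simp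
  qed
  show ?case
  proof
    fix z
    have *: "a y * (single y \<star> e X) z = 0" if "y \<in> F" for y
      using single[of y] step.prems that by (cases "a y = 0") (auto simp: fun_apply)
    show "(a \<star> e X) z = 0 z"
      unfolding conv_expand_left[of a] zero_fun_apply by (intro sum.neutral ballI *)
  qed
qed

lemma e_conv_e_not_le:
  assumes "X \<in> L" "Y \<in> L" "\<not> X \<le> Y"
  shows "e X \<star> e Y = 0"
proof (rule conv_e_eq_0)
  fix y assume "e X y \<noteq> 0"
  then have "X \<le> s y" using e_nonzero[OF assms(1), of y] by simp
  with assms(3) show "\<not> s y \<le> Y" by auto
qed fact

text \<open>Expanding the left factor reduces it to \<open>l X\<close>: the corrections contain some
  \<open>e Y\<close> with \<open>Y\<close> strictly above \<open>X\<close>, and this annihilates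
  \<open>e X\<close> from the left.\<close>

lemma e_idem: "X \<in> L \<Longrightarrow> e X \<star> e X = e X"
proof -
  assume X: "X \<in> L"
  have "e X \<star> e X = l X \<star> e X - (\<Sum>Y\<in>{Y \<in> L. X < Y}. l X \<star> (e Y \<star> e X))"
    by (subst e_rec[OF X]) (simp add: conv_diff_left conv_sum_left conv_assoc)
  also have "(\<Sum>Y\<in>{Y \<in> L. X < Y}. l X \<star> (e Y \<star> e X)) = 0"
    using X by (intro sum.neutral) (auto simp: e_conv_e_not_le)
  finally show ?thesis using X by (simp add: l_conv_e)
qed

text \<open>The case left over is \<open>X < Y\<close>. In the expanded left factor the induction
  hypothesis removes every correction except the one with \<open>Z = Y\<close>, which by idempotence
  of \<open>e Y\<close> equals the leading term and cancels it.\<close>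

lemma e_orthogonal: "X \<in> L \<Longrightarrow> Y \<in> L \<Longrightarrow> X \<noteq> Y \<Longrightarrow> e X \<star> e Y = 0"
proof (induction rule: downward_induct)
  case (step X)
  show ?case
  proof (cases "X \<le> Y")
    case True
    have "e X \<star> e Y = l X \<star> e Y - (\<Sum>Z\<in>{Z \<in> L. X < Z}. l X \<star> (e Z \<star> e Y))"
      by (subst e_rec[OF step.hyps]) (simp add: conv_diff_left conv_sum_left conv_assoc)
    also have "(\<Sum>Z\<in>{Z \<in> L. X < Z}. l X \<star> (e Z \<star> e Y))
        = (\<Sum>Z\<in>{Z \<in> L. X < Z}. if Z = Y then l X \<star> e Y else 0)"
    proof (intro sum.cong refl)
      fix Z assume "Z \<in> {Z \<in> L. X < Z}"
      then show "l X \<star> (e Z \<star> e Y) = (if Z = Y then l X \<star> e Y else 0)"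
        using step.IH[of Z] step.prems by (cases "Z = Y") (simp_all add: e_idem)
    qed
    also have "\<dots> = l X \<star> e Y"
      using True step.prems by (simp add: less_le)
    finally show ?thesis by simp
  next
    case False
    with step.hyps step.prems(1) show ?thesis by (rule e_conv_e_not_le)
  qed
qed

lemma e_sum: "(\<Sum>X\<in>L. e X) = single u"
proof -
  have "single u = (\<Sum>Y\<in>{Y \<in> L. s u \<le> Y}. single u \<star> e Y)"
    by (rule expand[of "s u"]) (simp_all split: if_splits)
  also have "\<dots> = (\<Sum>X\<in>L. e X)"
  proof (intro sum.cong)
    show "{Y \<in> L. s u \<le> Y} = L" by (auto simp: support_le_iff)
    show "single u \<star> e X = e X" if "X \<in> L" for X
      using e_nonzero[OF that] by (intro conv_unit_left) simp
  qed
  finally show ?thesis by simp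
qed

text \<open>The corrections live on supports above some \<open>Y\<close> strictly larger than
  \<open>s x\<close>, so the lowest stratum keeps the coefficients of \<open>l\<close>. This is what
  makes each idempotent non-zero.\<close>

lemma e_on_support:
  assumes "x \<in> F"
  shows "e (s x) x = l (s x) x"
proof -
  have "(l (s x) \<star> e Y) x = 0" if Y: "Y \<in> L" "s x < Y" for Y
  proof (rule ccontr)
    assume "(l (s x) \<star> e Y) x \<noteq> 0"
    then obtain y z where "y \<in> F" "z \<in> F" "e Y z \<noteq> 0" "x = m y z"
      by (rule conv_nonzeroE)
    then have "Y \<le> s x"
      using support_le_right[of y z] e_nonzero[OF Y(1), of z] by auto
    with Y show False by auto
  qed
  then have "(\<Sum>Y\<in>{Y \<in> L. s x < Y}. l (s x) \<star> e Y) x = 0"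
    unfolding sum_fun_apply by (intro sum.neutral) simp
  then show ?thesis
    using e_rec[of "s x"] assms by (simp add: minus_apply)
qed

lemma e_neq_0: "X \<in> L \<Longrightarrow> e X \<noteq> 0"
proof
  assume X: "X \<in> L" "e X = 0"
  have "l X x = 0" if "x \<in> F" for x
  proof (cases "s x = X")
    case True
    with e_on_support[OF that] X(2) show ?thesis by (simp add: zero_fun_apply)
  next
    case False
    with l_nonzero[OF X(1), of x] show ?thesis by auto
  qed
  with l_sum[OF X(1)] show False by simp
qed

lemma e_conv_e_sandwich:
  assumes "X \<in> L"
  shows "e X \<star> (a \<star> e X) = (\<lambda>z. (\<Sum>y\<in>{y \<in> F. s y \<le> X}. a y) * e X z)"
proof -
  \<comment> \<open>\<open>b\<close> keeps the part of \<open>a\<close> on supports below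
    \<open>X\<close>. The rest is killed by the \<open>e X\<close> to its right, while
    \<open>b\<close> is absorbed by the \<open>e X\<close> to its left.\<close>
  define b where "b = (\<lambda>y. if s y \<le> X then a y else 0)"
  have "(a - b) \<star> e X = 0"
    using assms by (intro conv_e_eq_0) (auto simp: b_def fun_apply split: if_splits)
  then have "e X \<star> (a \<star> e X) = (e X \<star> b) \<star> e X"
    by (simp add: conv_diff_left conv_assoc)
  also have "e X \<star> b = (\<lambda>z. (\<Sum>y\<in>F. b y) * e X z)"
    by (rule conv_absorb[OF e_nonzero[OF assms]]) (auto simp: b_def split: if_splits)
  also have "(\<Sum>y\<in>F. b y) = (\<Sum>y\<in>{y \<in> F. s y \<le> X}. a y)"
    by (simp add: b_def sum.inter_filter)
  finally show ?thesis
    using assms by (simp add: conv_scale_left e_idem)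
qed

text \<open>Multiplying by \<open>a\<close> on the right does not lower supports. When
  \<open>X < Y\<close> such a product may be non-zero, hence the importance of orbits being
  antichains.\<close>

lemma e_conv_e_sandwich_not_le:
  assumes "X \<in> L" "Y \<in> L" "\<not> X \<le> Y"
  shows "e X \<star> (a \<star> e Y) = 0"
proof -
  have "(e X \<star> a) \<star> e Y = 0"
  proof (rule conv_e_eq_0)
    fix z assume "(e X \<star> a) z \<noteq> 0"
    then obtain x y where "x \<in> F" "y \<in> F" "e X x \<noteq> 0" "z = m x y"
      by (rule conv_nonzeroE)
    then have "X \<le> s z"
      using support_le_left[of x y] e_nonzero[OF assms(1), of x] by auto
    with assms show "\<not> s z \<le> Y" by auto
  qed (use assms in auto)
  then show ?thesis by (simp add: conv_assoc)
qed

end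

section \<open>The face algebra\<close>

lemma face_algebra_simps [simp]:
  "mult (face_algebra A \<nu>) = conv (faces A \<nu>) (face_mult A \<nu>)"
  "one (face_algebra A \<nu>) = (\<lambda>x. if x = \<Inter>A then 1 else 0)"
  "zero (face_algebra A \<nu>) = 0"
  "add (face_algebra A \<nu>) = (+)"
  "carrier (face_algebra A \<nu>) = {a. \<forall>x. x \<notin> faces A \<nu> \<longrightarrow> a x = 0}"
  by (simp_all add: face_algebra_def conv_def fun_eq_iff fun_apply)

text \<open>An additively closed \<open>C\<close> covers the full algebra and the invariants at
  once: the monoid laws are those of functions.\<close>

lemma finsum_face_algebra:
  assumes C: "0 \<in> C" "\<And>a b. a \<in> C \<Longrightarrow> b \<in> C \<Longrightarrow> a + b \<in> C" and e: "\<And>i. i \<in> I \<Longrightarrow> e i \<in> C"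
  shows "finsum ((face_algebra A \<nu>)\<lparr>carrier := C\<rparr>) e I = (\<Sum>i\<in>I. e i)"
proof -
  interpret abelian_monoid "(face_algebra A \<nu>)\<lparr>carrier := C\<rparr>"
    by (rule abelian_monoidI) (use C in \<open>auto simp: algebra_simps\<close>)
  show ?thesis
    using e by (induction I rule: infinite_finite_induct) auto
qed

lemma finsum_face_algebra_carrier:
  assumes "\<And>i. i \<in> I \<Longrightarrow> e i \<in> carrier (face_algebra A \<nu>)"
  shows "finsum (face_algebra A \<nu>) e I = (\<Sum>i\<in>I. e i)"
proof -
  let ?C = "carrier (face_algebra A \<nu>)"
  have C: "(face_algebra A \<nu>)\<lparr>carrier := ?C\<rparr> = face_algebra A \<nu>"
    by (simp add: face_algebra_def)
  have "finsum ((face_algebra A \<nu>)\<lparr>carrier := ?C\<rparr>) e I = (\<Sum>i\<in>I. e i)"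
    using assms by (intro finsum_face_algebra) (auto simp: fun_apply)
  then show ?thesis unfolding C .
qed

text \<open>An orthogonal splitting \<open>e = f + g\<close> gives f = e f e = c e, and idempotence
  of \<open>f\<close> forces \<open>c * c = c\<close>. So \<open>f\<close> is 0 or
  \<open>e\<close>.\<close>

lemma primitive_idempotentI:
  assumes e: "e \<in> C" "conv (faces A \<nu>) (face_mult A \<nu>) e e = e" "e \<noteq> 0"
    and sandwich: "\<And>f. f \<in> C \<Longrightarrow> \<exists>c. conv (faces A \<nu>) (face_mult A \<nu>) e (conv (faces A \<nu>) (face_mult A \<nu>) f e)
                      = (\<lambda>x. c * e x)"
  shows "primitive_idempotent ((face_algebra A \<nu>)\<lparr>carrier := C\<rparr>) e"
proof -
  let ?cv = "conv (faces A \<nu>) (face_mult A \<nu>)"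
  have "f = 0 \<or> g = 0"
    if fg: "f \<in> C" "?cv f f = f" "?cv f g = 0" "?cv g f = 0" "e = f + g" for f g
  proof -
    have "?cv e (?cv f e) = f"
      using fg by (simp add: conv_add_left conv_add_right)
    with sandwich[OF fg(1)] obtain c where c: "f = (\<lambda>x. c * e x)" by auto
    then have cc: "(\<lambda>x. c * (c * e x)) = (\<lambda>x. c * e x)"
      using fg(2) e(2) by (simp add: conv_scale_left conv_scale_right)
    obtain x where "e x \<noteq> 0"
      using e(3) by (auto simp: fun_eq_iff fun_apply)
    with fun_cong[OF cc, of x] have "c = 0 \<or> c = 1"
      by auto
    then show "f = 0 \<or> g = 0"
    proof
      assume "c = 0"
      with c have "f = 0" by (simp add: fun_eq_iff fun_apply)
      then show ?thesis ..
    next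
      assume "c = 1"
      with c have "f = e" by simp
      with fg(5) show ?thesis by simp
    qed
  qed
  with e show ?thesis
    unfolding primitive_idempotent_def by simp
qed

section \<open>Faces as cells\<close>

definition sg :: "real \<Rightarrow> sign" where
  "sg t = (if t > 0 then Pos else if t < 0 then Neg else Zero)"

lemma sg_zero [simp]: "sg 0 = Zero" and sg_eq_Zero_iff [simp]: "sg t = Zero \<longleftrightarrow> t = 0"
  by (auto simp: sg_def)

text \<open>Negative \<open>c\<close> matters here: a symmetry may carry the chosen normal of a
  hyperplane to a negative multiple of the chosen normal of the image.\<close>

lemma sg_mult_cong: "sg t = sg t' \<Longrightarrow> sg (c * t) = sg (c * t')"
  by (auto simp: sg_def zero_less_mult_iff mult_less_0_iff split: if_splits)

definition sign_comp :: "sign \<Rightarrow> sign \<Rightarrow> sign" where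
  "sign_comp a b = (if a \<noteq> Zero then a else b)"

lemma sg_mult_sign_comp:
  "sg t = sign_comp (sg a) (sg b) \<Longrightarrow> sg (c * t) = sign_comp (sg (c * a)) (sg (c * b))"
  by (auto simp: sg_def sign_comp_def zero_less_mult_iff mult_less_0_iff split: if_splits)

text \<open>Moving from \<open>u\<close> a little in the direction of \<open>v\<close> gives a point of the product of their faces.\<close>

lemma eventually_sg_comp:
  fixes a b :: real
  shows "\<forall>\<^sub>F t in at_right 0. sg (a + t * b) = sign_comp (sg a) (sg b)"
proof -
  have lim: "((\<lambda>t. a + t * b) \<longlongrightarrow> a + 0 * b) (at_right 0)"
    by (intro tendsto_intros)
  have pos: "\<forall>\<^sub>F t in at_right (0::real). t > 0"
    by (rule eventually_at_right_less)
  consider "a > 0" | "a < 0" | "a = 0" by linarith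
  then show ?thesis
  proof cases
    case 1
    with lim have "\<forall>\<^sub>F t in at_right 0. a + t * b > 0" by (intro order_tendstoD) auto
    with 1 show ?thesis by (auto elim!: eventually_mono simp: sg_def sign_comp_def)
  next
    case 2
    with lim have "\<forall>\<^sub>F t in at_right 0. a + t * b < 0" by (intro order_tendstoD) auto
    with 2 show ?thesis by (auto elim!: eventually_mono simp: sg_def sign_comp_def)
  next
    case 3
    with pos show ?thesis
      by (auto elim!: eventually_mono simp: sg_def sign_comp_def zero_less_mult_iff mult_less_0_iff)
  qed
qed

locale finite_arrangement =
  fixes A :: "'v::real_inner set set" and \<nu> :: "'v set \<Rightarrow> 'v"
  assumes finite_A: "finite A" and labelling: "half_space_labelling A \<nu>"
begin

text \<open>Describing faces by points instead of sign functions builds in non-emptiness: every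
  \<open>cell\<close> is a face, and a face is the \<open>cell\<close> of each of its
  points.\<close>

definition cell :: "'v \<Rightarrow> 'v set" where
  "cell v = {u. \<forall>H\<in>A. sg (\<nu> H \<bullet> u) = sg (\<nu> H \<bullet> v)}"

lemma mem_hyperplane_iff: "H \<in> A \<Longrightarrow> v \<in> H \<longleftrightarrow> \<nu> H \<bullet> v = 0"
  using labelling unfolding half_space_labelling_def by blast

lemma mem_region_iff: "H \<in> A \<Longrightarrow> v \<in> region \<nu> H \<sigma> \<longleftrightarrow> sg (\<nu> H \<bullet> v) = \<sigma>"
  by (cases \<sigma>) (auto simp: mem_hyperplane_iff sg_def)

lemma mem_cell [simp]: "v \<in> cell v"
  by (simp add: cell_def)

lemma cell_eq_iff: "cell u = cell v \<longleftrightarrow> (\<forall>H\<in>A. sg (\<nu> H \<bullet> u) = sg (\<nu> H \<bullet> v))"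
  using mem_cell[of u] by (auto simp: cell_def)

lemma INT_region: "(\<Inter>H\<in>A. region \<nu> H (\<sigma> H)) = {u. \<forall>H\<in>A. sg (\<nu> H \<bullet> u) = \<sigma> H}"
  by (auto simp: mem_region_iff)

lemma faces_eq: "faces A \<nu> = range cell"
proof (intro equalityI subsetI)
  fix x assume "x \<in> faces A \<nu>"
  then obtain \<sigma> v where "x = {u. \<forall>H\<in>A. sg (\<nu> H \<bullet> u) = \<sigma> H}" "v \<in> x"
    by (auto simp: faces_def INT_region)
  then have "x = cell v" by (auto simp: cell_def)
  then show "x \<in> range cell" by blast
next
  fix x assume "x \<in> range cell"
  then obtain v where x: "x = cell v" by blast
  then have "x = (\<Inter>H\<in>A. region \<nu> H (sg (\<nu> H \<bullet> v)))"
    unfolding INT_region by (simp add: cell_def)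
  moreover have "x \<noteq> {}" using x mem_cell[of v] by blast
  ultimately show "x \<in> faces A \<nu>"
    unfolding faces_def by (intro CollectI conjI exI[of _ "\<lambda>H. sg (\<nu> H \<bullet> v)"])
qed

lemma face_sign_cell: "H \<in> A \<Longrightarrow> face_sign \<nu> (cell v) H = sg (\<nu> H \<bullet> v)"
  unfolding face_sign_def
proof (rule the_equality)
  fix \<sigma> assume H: "H \<in> A" and "cell v \<subseteq> region \<nu> H \<sigma>"
  from this(2) have "v \<in> region \<nu> H \<sigma>" by (rule subsetD[OF _ mem_cell])
  with H show "\<sigma> = sg (\<nu> H \<bullet> v)" by (simp add: mem_region_iff)
qed (auto simp: mem_region_iff cell_def)

text \<open>Since there are finitely many hyperplanes, one small \<open>t\<close> serves them all,
  and the point \<open>u + t *\<^sub>R v\<close> represents the product.\<close>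

lemma face_mult_cell:
  obtains w where "face_mult A \<nu> (cell u) (cell v) = cell w"
    "\<And>H. H \<in> A \<Longrightarrow> sg (\<nu> H \<bullet> w) = sign_comp (sg (\<nu> H \<bullet> u)) (sg (\<nu> H \<bullet> v))"
proof -
  have "\<forall>\<^sub>F t in at_right 0. \<forall>H\<in>A.
      sg (\<nu> H \<bullet> (u + t *\<^sub>R v)) = sign_comp (sg (\<nu> H \<bullet> u)) (sg (\<nu> H \<bullet> v))"
    using finite_A by (auto intro!: eventually_ball_finite eventually_sg_comp simp: inner_add_right)
  then obtain t where t: "\<forall>H\<in>A.
      sg (\<nu> H \<bullet> (u + t *\<^sub>R v)) = sign_comp (sg (\<nu> H \<bullet> u)) (sg (\<nu> H \<bullet> v))"
    using eventually_happens'[OF trivial_limit_at_right_real] by blast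
  have "cell (u + t *\<^sub>R v)
      = {p. \<forall>H\<in>A. sg (\<nu> H \<bullet> p) = sign_comp (sg (\<nu> H \<bullet> u)) (sg (\<nu> H \<bullet> v))}"
    using t by (simp add: cell_def)
  then have "face_mult A \<nu> (cell u) (cell v) = cell (u + t *\<^sub>R v)"
    unfolding face_mult_def INT_region by (simp add: face_sign_cell sign_comp_def)
  with t that show thesis by blast
qed

lemma cell_subset_iff: "H \<in> A \<Longrightarrow> cell v \<subseteq> H \<longleftrightarrow> \<nu> H \<bullet> v = 0"
  using mem_cell[of v] by (auto simp: subset_iff mem_hyperplane_iff cell_def)

lemma supp_le_iff: "supp A (cell u) \<subseteq> supp A (cell v) \<longleftrightarrow> (\<forall>H\<in>A. \<nu> H \<bullet> v = 0 \<longrightarrow> \<nu> H \<bullet> u = 0)"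
proof
  assume *: "supp A (cell u) \<subseteq> supp A (cell v)"
  have "u \<in> supp A (cell u)" using mem_cell[of u] by (auto simp: supp_def)
  with * show "\<forall>H\<in>A. \<nu> H \<bullet> v = 0 \<longrightarrow> \<nu> H \<bullet> u = 0"
    by (auto simp: supp_def cell_subset_iff mem_hyperplane_iff)
qed (auto simp: supp_def cell_subset_iff)

lemma Inter_eq_cell: "\<Inter>A = cell 0"
  by (auto simp: cell_def mem_hyperplane_iff)

lemma finite_faces: "finite (faces A \<nu>)"
proof -
  have UNIV: "(UNIV :: sign set) = {Neg, Zero, Pos}"
    using sign.exhaust by auto
  have "finite (PiE A (\<lambda>_. UNIV :: sign set))"
    using finite_A by (intro finite_PiE) (simp_all add: UNIV)
  moreover have "faces A \<nu> \<subseteq> (\<lambda>\<sigma>. \<Inter>H\<in>A. region \<nu> H (\<sigma> H)) ` PiE A (\<lambda>_. UNIV)"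
  proof
    fix x assume "x \<in> faces A \<nu>"
    then obtain \<sigma> where "x = (\<Inter>H\<in>A. region \<nu> H (\<sigma> H))" by (auto simp: faces_def)
    then show "x \<in> (\<lambda>\<sigma>. \<Inter>H\<in>A. region \<nu> H (\<sigma> H)) ` PiE A (\<lambda>_. UNIV)"
      by (intro image_eqI[of _ _ "restrict \<sigma> A"]) simp_all
  qed
  ultimately show ?thesis by (rule finite_surj)
qed

text \<open>Signs under \<open>sign_comp\<close> obey the same laws, so each axiom is checked
  hyperplane by hyperplane on points representing the products. The unit is represented by the
  origin.\<close>

sublocale left_regular_band "faces A \<nu>" "face_mult A \<nu>" "\<Inter>A" "supp A"
proof
  fix x y z assume "x \<in> faces A \<nu>" "y \<in> faces A \<nu>" "z \<in> faces A \<nu>"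
  then obtain a b c where abc: "x = cell a" "y = cell b" "z = cell c"
    by (auto simp: faces_eq)
  obtain ab where ab: "face_mult A \<nu> x y = cell ab"
    "\<And>H. H \<in> A \<Longrightarrow> sg (\<nu> H \<bullet> ab) = sign_comp (sg (\<nu> H \<bullet> a)) (sg (\<nu> H \<bullet> b))"
    unfolding abc using face_mult_cell by blast
  obtain bc where bc: "face_mult A \<nu> y z = cell bc"
    "\<And>H. H \<in> A \<Longrightarrow> sg (\<nu> H \<bullet> bc) = sign_comp (sg (\<nu> H \<bullet> b)) (sg (\<nu> H \<bullet> c))"
    unfolding abc using face_mult_cell by blast
  obtain p where p: "face_mult A \<nu> (cell ab) z = cell p"
    "\<And>H. H \<in> A \<Longrightarrow> sg (\<nu> H \<bullet> p) = sign_comp (sg (\<nu> H \<bullet> ab)) (sg (\<nu> H \<bullet> c))"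
    unfolding abc using face_mult_cell by blast
  obtain q where q: "face_mult A \<nu> x (cell bc) = cell q"
    "\<And>H. H \<in> A \<Longrightarrow> sg (\<nu> H \<bullet> q) = sign_comp (sg (\<nu> H \<bullet> a)) (sg (\<nu> H \<bullet> bc))"
    unfolding abc using face_mult_cell by blast
  show "face_mult A \<nu> (face_mult A \<nu> x y) z = face_mult A \<nu> x (face_mult A \<nu> y z)"
    by (auto simp: ab bc p q cell_eq_iff sign_comp_def)
next
  fix x y assume "x \<in> faces A \<nu>" "y \<in> faces A \<nu>"
  then obtain a b where abc: "x = cell a" "y = cell b"
    by (auto simp: faces_eq)
  obtain ab where ab: "face_mult A \<nu> x y = cell ab"
    "\<And>H. H \<in> A \<Longrightarrow> sg (\<nu> H \<bullet> ab) = sign_comp (sg (\<nu> H \<bullet> a)) (sg (\<nu> H \<bullet> b))"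
    unfolding abc using face_mult_cell by blast
  obtain ba where ba: "face_mult A \<nu> y x = cell ba"
    "\<And>H. H \<in> A \<Longrightarrow> sg (\<nu> H \<bullet> ba) = sign_comp (sg (\<nu> H \<bullet> b)) (sg (\<nu> H \<bullet> a))"
    unfolding abc using face_mult_cell by blast
  obtain p where p: "face_mult A \<nu> (cell ab) x = cell p"
    "\<And>H. H \<in> A \<Longrightarrow> sg (\<nu> H \<bullet> p) = sign_comp (sg (\<nu> H \<bullet> ab)) (sg (\<nu> H \<bullet> a))"
    unfolding abc using face_mult_cell by blast
  show "face_mult A \<nu> x y \<in> faces A \<nu>"
    by (simp add: ab faces_eq)
  show "face_mult A \<nu> (face_mult A \<nu> x y) x = face_mult A \<nu> x y"
    by (auto simp: ab p cell_eq_iff sign_comp_def)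
  \<comment> \<open>On each hyperplane the composed sign equals that of \<open>b\<close> exactly
    when \<open>b\<close> is off the hyperplane or \<open>a\<close> is on it, which is the criterion
    of \<open>supp_le_iff\<close>.\<close>
  have "supp A x \<subseteq> supp A y \<longleftrightarrow> cell ba = cell b"
    unfolding abc supp_le_iff cell_eq_iff by (auto simp: ba sign_comp_def)
  then show "supp A x \<subseteq> supp A y \<longleftrightarrow> face_mult A \<nu> y x = y"
    unfolding ba(1) unfolding abc .
next
  fix x assume "x \<in> faces A \<nu>"
  then obtain a where a: "x = cell a"
    by (auto simp: faces_eq)
  obtain p where p: "face_mult A \<nu> x (\<Inter>A) = cell p"
    "\<And>H. H \<in> A \<Longrightarrow> sg (\<nu> H \<bullet> p) = sign_comp (sg (\<nu> H \<bullet> a)) (sg (\<nu> H \<bullet> 0))"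
    unfolding a Inter_eq_cell using face_mult_cell by blast
  show "face_mult A \<nu> x (\<Inter>A) = x"
    unfolding p(1) unfolding a cell_eq_iff by (simp add: p(2) sign_comp_def)
  obtain q where q: "face_mult A \<nu> (\<Inter>A) x = cell q"
    "\<And>H. H \<in> A \<Longrightarrow> sg (\<nu> H \<bullet> q) = sign_comp (sg (\<nu> H \<bullet> 0)) (sg (\<nu> H \<bullet> a))"
    unfolding a Inter_eq_cell using face_mult_cell by blast
  show "face_mult A \<nu> (\<Inter>A) x = x"
    unfolding q(1) unfolding a cell_eq_iff by (simp add: q(2) sign_comp_def)
next
  show "\<Inter>A \<in> faces A \<nu>" by (simp add: Inter_eq_cell faces_eq)
qed (rule finite_faces)

abbreviation face_conv :: "('v set \<Rightarrow> 'k::field) \<Rightarrow> ('v set \<Rightarrow> 'k) \<Rightarrow> 'v set \<Rightarrow> 'k" (infixl "\<star>" 70) where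
  "a \<star> b \<equiv> conv (faces A \<nu>) (face_mult A \<nu>) a b"

end

section \<open>Symmetries of the arrangement\<close>

locale symmetric_arrangement = finite_arrangement A \<nu>
  for A :: "'v::real_inner set set" and \<nu> +
  fixes W :: "('v \<Rightarrow> 'v) set"
  assumes orthogonal: "w \<in> W \<Longrightarrow> orthogonal_transformation w"
    and id_mem: "id \<in> W"
    and comp_mem: "w \<in> W \<Longrightarrow> w' \<in> W \<Longrightarrow> w \<circ> w' \<in> W"
    and inverse_mem: "w \<in> W \<Longrightarrow> \<exists>w'\<in>W. w \<circ> w' = id \<and> w' \<circ> w = id"
    and image_hyperplane: "w \<in> W \<Longrightarrow> H \<in> A \<Longrightarrow> w ` H \<in> A"
begin

lemma inverseE:
  assumes "w \<in> W"
  obtains w' where "w' \<in> W" "\<And>v. w (w' v) = v" "\<And>v. w' (w v) = v"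
proof -
  obtain w' where w': "w' \<in> W" "w \<circ> w' = id" "w' \<circ> w = id"
    using inverse_mem[OF assms] by blast
  show thesis
    by (rule that[OF w'(1)]) (use w' in \<open>simp_all add: pointfree_idE\<close>)
qed

lemma bij: "w \<in> W \<Longrightarrow> bij w"
  using inverse_mem o_bij by blast

lemma inj_image: "w \<in> W \<Longrightarrow> inj_on ((`) w) S"
  using bij bij_is_inj inj_image_eq_iff by (metis inj_onI)

lemma inner_image: "w \<in> W \<Longrightarrow> w a \<bullet> w b = a \<bullet> b"
  using orthogonal by (simp add: orthogonal_transformation_def)

text \<open>\<open>w\<close> carries \<open>\<nu> H\<close> to a normal of the image hyperplane, but
  the normals are labelled independently of each other, so it agrees with the chosen one only up to
  a non-zero, possibly negative, factor.\<close>

lemma normal_image: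
  assumes w: "w \<in> W" and H: "H \<in> A"
  obtains c where "c \<noteq> 0" "\<And>v. \<nu> (w ` H) \<bullet> w v = c * (\<nu> H \<bullet> v)"
proof -
  obtain w' where w': "\<And>v. w (w' v) = v" "\<And>v. w' (w v) = v"
    using inverseE[OF w] by metis
  define n N where "n = w (\<nu> H)" and "N = \<nu> (w ` H)"
  have "\<nu> H \<noteq> 0" and N: "N \<noteq> 0"
    using labelling H image_hyperplane[OF w H] by (auto simp: half_space_labelling_def N_def)
  then have n: "n \<bullet> n \<noteq> 0" by (simp add: n_def inner_image[OF w])
  have orth: "N \<bullet> v = 0 \<longleftrightarrow> n \<bullet> v = 0" for v
  proof -
    have "N \<bullet> v = 0 \<longleftrightarrow> v \<in> w ` H"
      using mem_hyperplane_iff[OF image_hyperplane[OF w H]] by (simp add: N_def)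
    also have "\<dots> \<longleftrightarrow> w' v \<in> H"
      by (metis image_iff w')
    also have "\<dots> \<longleftrightarrow> n \<bullet> v = 0"
      using mem_hyperplane_iff[OF H] inner_image[OF w, of "\<nu> H" "w' v"] by (simp add: n_def w')
    finally show ?thesis .
  qed
  \<comment> \<open>\<open>c\<close> is the coefficient of the projection of \<open>N\<close> onto
    \<open>n\<close>. The remainder \<open>d\<close> is orthogonal to \<open>n\<close>, hence to
    \<open>N\<close> by \<open>orth\<close>, hence to itself.\<close>
  define c where "c = (N \<bullet> n) / (n \<bullet> n)"
  define d where "d = N - c *\<^sub>R n"
  have "n \<bullet> d = 0"
    using n by (simp add: d_def c_def inner_diff_right inner_commute)
  then have "d \<bullet> d = 0"
    using orth[of d] by (simp add: d_def inner_diff_left)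
  then have N_eq: "N = c *\<^sub>R n" by (simp add: d_def)
  with N have "c \<noteq> 0" by auto
  moreover have "\<nu> (w ` H) \<bullet> w v = c * (\<nu> H \<bullet> v)" for v
    using N_eq by (simp add: N_def n_def inner_image[OF w])
  ultimately show thesis using that by blast
qed

lemma hyperplane_preimage:
  assumes w: "w \<in> W" and H: "H \<in> A"
  obtains H' where "H' \<in> A" "H = w ` H'"
proof -
  obtain w' where w': "w' \<in> W" "\<And>v. w (w' v) = v"
    using inverseE[OF w] by metis
  then have "H = w ` (w' ` H)" by (simp add: image_image)
  with that image_hyperplane[OF w'(1) H] show thesis by blast
qed

lemma image_cell_subset:
  assumes w: "w \<in> W"
  shows "w ` cell v \<subseteq> cell (w v)"
proof
  fix y assume "y \<in> w ` cell v"
  then obtain u where u: "u \<in> cell v" "y = w u" by blast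
  have "sg (\<nu> H \<bullet> w u) = sg (\<nu> H \<bullet> w v)" if H: "H \<in> A" for H
  proof -
    obtain H' where H': "H' \<in> A" "H = w ` H'" using hyperplane_preimage[OF w H] .
    obtain c where "\<And>v. \<nu> H \<bullet> w v = c * (\<nu> H' \<bullet> v)"
      using normal_image[OF w H'(1)] unfolding H'(2) by metis
    with u(1) H'(1) show ?thesis by (auto simp: cell_def intro: sg_mult_cong)
  qed
  with u show "y \<in> cell (w v)" by (simp add: cell_def)
qed

lemma image_cell:
  assumes w: "w \<in> W"
  shows "w ` cell v = cell (w v)"
proof
  obtain w' where w': "w' \<in> W" "\<And>v. w (w' v) = v" "\<And>v. w' (w v) = v"
    using inverseE[OF w] by metis
  have "w ` (w' ` cell (w v)) \<subseteq> w ` cell v"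
    using image_cell_subset[OF w'(1), of "w v"] by (intro image_mono) (simp add: w')
  then show "cell (w v) \<subseteq> w ` cell v" by (simp add: image_image w')
qed (rule image_cell_subset[OF w])

lemma image_face: "w \<in> W \<Longrightarrow> x \<in> faces A \<nu> \<Longrightarrow> w ` x \<in> faces A \<nu>"
  by (auto simp: faces_eq image_cell)

lemma bij_betw_image:
  assumes "\<And>w x. w \<in> W \<Longrightarrow> x \<in> S \<Longrightarrow> w ` x \<in> S" and w: "w \<in> W"
  shows "bij_betw ((`) w) S S"
proof -
  obtain w' where w': "w' \<in> W" "\<And>v. w (w' v) = v" "\<And>v. w' (w v) = v"
    using inverseE[OF w] by metis
  show ?thesis
    by (rule bij_betw_byWitness[of _ "(`) w'"]) (use assms w' in \<open>auto simp: image_image\<close>)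
qed

lemma bij_faces: "w \<in> W \<Longrightarrow> bij_betw ((`) w) (faces A \<nu>) (faces A \<nu>)"
  by (intro bij_betw_image image_face)

text \<open>The factor \<open>c\<close> of \<open>normal_image\<close> scales all three values on a
  hyperplane alike, and \<open>sign_comp\<close> is compatible with such a scaling even when it
  reverses signs.\<close>

lemma face_mult_image:
  assumes w: "w \<in> W" and "x \<in> faces A \<nu>" "y \<in> faces A \<nu>"
  shows "face_mult A \<nu> (w ` x) (w ` y) = w ` face_mult A \<nu> x y"
proof -
  obtain a b where ab: "x = cell a" "y = cell b" using assms by (auto simp: faces_eq)
  obtain p where p: "face_mult A \<nu> (cell a) (cell b) = cell p"
    "\<And>H. H \<in> A \<Longrightarrow> sg (\<nu> H \<bullet> p) = sign_comp (sg (\<nu> H \<bullet> a)) (sg (\<nu> H \<bullet> b))"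
    using face_mult_cell by blast
  obtain q where q: "face_mult A \<nu> (cell (w a)) (cell (w b)) = cell q"
    "\<And>H. H \<in> A \<Longrightarrow> sg (\<nu> H \<bullet> q) = sign_comp (sg (\<nu> H \<bullet> w a)) (sg (\<nu> H \<bullet> w b))"
    using face_mult_cell by blast
  have "sg (\<nu> H \<bullet> w p) = sign_comp (sg (\<nu> H \<bullet> w a)) (sg (\<nu> H \<bullet> w b))" if H: "H \<in> A" for H
  proof -
    obtain H' where H': "H' \<in> A" "H = w ` H'" using hyperplane_preimage[OF w H] .
    obtain c where c: "\<And>v. \<nu> H \<bullet> w v = c * (\<nu> H' \<bullet> v)"
      using normal_image[OF w H'(1)] unfolding H'(2) by metis
    show ?thesis unfolding c by (rule sg_mult_sign_comp[OF p(2)[OF H'(1)]])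
  qed
  then have "cell q = cell (w p)"
    by (simp add: cell_eq_iff q(2))
  then show ?thesis
    unfolding ab image_cell[OF w] p(1) q(1) .
qed

text \<open>\<open>w\<close> matches the hyperplanes containing \<open>x\<close> with those
  containing its image; as a bijection it commutes with intersections, the empty one
  included.\<close>

lemma supp_image:
  assumes w: "w \<in> W"
  shows "supp A (w ` x) = w ` supp A x"
proof -
  have "inj w" using bij[OF w] by (rule bij_is_inj)
  have "{H \<in> A. w ` x \<subseteq> H} = (`) w ` {H \<in> A. x \<subseteq> H}"
  proof (intro equalityI subsetI)
    fix H assume H: "H \<in> {H \<in> A. w ` x \<subseteq> H}"
    then obtain H' where "H' \<in> A" "H = w ` H'" using hyperplane_preimage[OF w] by blast
    with H \<open>inj w\<close> show "H \<in> (`) w ` {H \<in> A. x \<subseteq> H}" by (auto simp: inj_image_subset_iff)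
  qed (use image_hyperplane[OF w] in auto)
  then show ?thesis
    using bij_image_INT[OF bij[OF w], of "\<lambda>H. H" "{H \<in> A. x \<subseteq> H}"] by (simp add: supp_def)
qed

lemma image_lattice:
  assumes "w \<in> W" "X \<in> supp A ` faces A \<nu>"
  shows "w ` X \<in> supp A ` faces A \<nu>"
proof -
  obtain x where "x \<in> faces A \<nu>" "X = supp A x" using assms(2) by blast
  with image_face[OF assms(1)] supp_image[OF assms(1)] show ?thesis
    by (intro image_eqI[of _ _ "w ` x"]) simp_all
qed

lemma bij_lattice: "w \<in> W \<Longrightarrow> bij_betw ((`) w) (supp A ` faces A \<nu>) (supp A ` faces A \<nu>)"
  by (intro bij_betw_image image_lattice)

text \<open>\<open>w\<close> acts on the lattice by an order automorphism. This reindexes the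
  recursion and later compares the numbers of elements above two members of an orbit.\<close>

lemma image_above:
  assumes w: "w \<in> W"
  shows "{Y \<in> supp A ` faces A \<nu>. w ` X \<subset> Y} = (`) w ` {Y \<in> supp A ` faces A \<nu>. X \<subset> Y}"
    (is "?R = (`) w ` ?S")
proof (intro equalityI subsetI)
  have iff: "w ` X \<subset> w ` Y \<longleftrightarrow> X \<subset> Y" for Y
    using bij_is_inj[OF bij[OF w]] by (simp add: inj_image_subset_iff psubset_eq inj_image_eq_iff)
  show "Y \<in> ?R" if Y: "Y \<in> (`) w ` ?S" for Y
  proof -
    obtain Z where "Z \<in> supp A ` faces A \<nu>" "X \<subset> Z" "Y = w ` Z"
      using Y by auto
    then show ?thesis using iff[of Z] image_lattice[OF w, of Z] by simp
  qed
  fix Y assume Y: "Y \<in> ?R"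
  then have "Y \<in> (`) w ` supp A ` faces A \<nu>"
    using bij_betw_imp_surj_on[OF bij_lattice[OF w]] by simp
  then obtain Z where Z: "Z \<in> supp A ` faces A \<nu>" "Y = w ` Z"
    by blast
  with Y iff[of Z] have "X \<subset> Z" by simp
  with Z show "Y \<in> (`) w ` ?S" by blast
qed

lemma algebra_act_image: "w \<in> W \<Longrightarrow> algebra_act w a (w ` x) = a x"
  by (simp add: algebra_act_def inj_vimage_image_eq bij bij_is_inj)

lemma algebra_act_conv:
  fixes a b :: "'v set \<Rightarrow> 'b::field"
  assumes w: "w \<in> W"
  shows "algebra_act w (a \<star> b) = algebra_act w a \<star> algebra_act w b"
proof
  fix z
  have z: "w ` t = z \<longleftrightarrow> t = w -` z" for t
    using bij[OF w] by (metis bij_def inj_vimage_image_eq surj_image_vimage_eq)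
  have reindex: "(\<Sum>x\<in>faces A \<nu>. g x) = (\<Sum>x\<in>faces A \<nu>. g (w ` x))" for g :: "'v set \<Rightarrow> 'b"
    by (rule sum.reindex_bij_betw[OF bij_faces[OF w], symmetric])
  have "(algebra_act w a \<star> algebra_act w b) z
      = (\<Sum>x\<in>faces A \<nu>. \<Sum>y\<in>faces A \<nu>. algebra_act w a (w ` x) * algebra_act w b (w ` y)
           * (if face_mult A \<nu> (w ` x) (w ` y) = z then 1 else 0))"
    unfolding conv_alt by (rule trans[OF reindex]) (intro sum.cong refl reindex)
  also have "\<dots> = (a \<star> b) (w -` z)"
    unfolding conv_alt
    by (intro sum.cong refl) (simp add: algebra_act_image[OF w] face_mult_image[OF w] z)
  finally show "algebra_act w (a \<star> b) z = (algebra_act w a \<star> algebra_act w b) z"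
    by (simp add: algebra_act_def)
qed

lemma algebra_act_diff: "algebra_act w (a - b) = algebra_act w a - algebra_act w b"
  by (simp add: algebra_act_def fun_eq_iff fun_apply)

lemma algebra_act_add: "algebra_act w (a + b) = algebra_act w a + algebra_act w b"
  by (simp add: algebra_act_def fun_eq_iff fun_apply)

lemma algebra_act_sum: "algebra_act w (\<Sum>i\<in>I. a i) = (\<Sum>i\<in>I. algebra_act w (a i))"
  by (simp add: algebra_act_def fun_eq_iff fun_apply)

end

section \<open>Idempotents of the face algebra and their equivariance\<close>

locale equivariant_sections = symmetric_arrangement A \<nu> W
  for A :: "'v::real_inner set set" and \<nu> W +
  fixes l :: "'v set \<Rightarrow> 'v set \<Rightarrow> 'k::field"
  assumes sections: "X \<in> intersection_lattice A \<nu> \<Longrightarrow> support_section A \<nu> X (l X)"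
    and equivariant:
      "w \<in> W \<Longrightarrow> X \<in> intersection_lattice A \<nu> \<Longrightarrow> algebra_act w (l X) = l (w ` X)"
begin

abbreviation e :: "'v set \<Rightarrow> 'v set \<Rightarrow> 'k" where
  "e \<equiv> face_idempotent A \<nu> l"

text \<open>\<open>face_idempotent\<close> enters through its recursion, which is what the abstract
  \<open>e\<close> assumes. Its finiteness test succeeds because the lattice is an image of the
  finite set of faces.\<close>

sublocale band_idempotents "faces A \<nu>" "face_mult A \<nu>" "\<Inter>A" "supp A" l e
proof
  fix X assume X: "X \<in> supp A ` faces A \<nu>"
  then have *: "support_section A \<nu> X (l X)"
    by (intro sections) (simp add: intersection_lattice_def)
  then show "(\<Sum>x\<in>faces A \<nu>. l X x) = 1"
    by (simp add: support_section_def)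
  show "x \<in> faces A \<nu> \<and> supp A x = X" if "l X x \<noteq> 0" for x
    using * that by (simp add: support_section_def)
  have "finite (intersection_lattice A \<nu>)"
    by (simp add: intersection_lattice_def)
  then show "e X = l X - (\<Sum>Y\<in>{Y \<in> supp A ` faces A \<nu>. X \<subset> Y}. l X \<star> e Y)"
    by (subst face_idempotent.simps) (simp add: fun_eq_iff fun_apply intersection_lattice_def)
qed

lemma lattice_eq: "intersection_lattice A \<nu> = L"
  by (simp add: intersection_lattice_def)

text \<open>The action passes through the recursion as an algebra map, and \<open>w\<close> maps the
  elements above \<open>X\<close> onto those above its image.\<close>

lemma e_equivariant:
  assumes w: "w \<in> W" and "X \<in> L"
  shows "algebra_act w (e X) = e (w ` X)"
  using assms(2)
proof (induction rule: downward_induct)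
  case (step X)
  have "algebra_act w (e X)
      = l (w ` X) - (\<Sum>Y\<in>{Y \<in> L. X \<subset> Y}. l (w ` X) \<star> algebra_act w (e Y))"
    unfolding e_rec[OF step.hyps] algebra_act_diff algebra_act_sum
    using equivariant[OF w] step.hyps by (simp add: algebra_act_conv[OF w] lattice_eq)
  also have "(\<Sum>Y\<in>{Y \<in> L. X \<subset> Y}. l (w ` X) \<star> algebra_act w (e Y))
      = (\<Sum>Y\<in>{Y \<in> L. X \<subset> Y}. l (w ` X) \<star> e (w ` Y))"
    using step.IH by (intro sum.cong refl) simp
  also have "\<dots> = (\<Sum>Y\<in>{Y \<in> L. w ` X \<subset> Y}. l (w ` X) \<star> e Y)"
    unfolding image_above[OF w] by (simp add: sum.reindex[OF inj_image[OF w]] o_def)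
  finally show ?case
    using e_rec[OF image_lattice[OF w step.hyps]] by simp
qed

lemma e_closed:
  assumes "X \<in> L"
  shows "e X \<in> carrier (face_algebra A \<nu>)"
  using e_nonzero[OF assms] by auto

theorem complete_idempotents:
  "complete_primitive_orthogonal_idempotents (face_algebra A \<nu>) (intersection_lattice A \<nu>) e"
  unfolding complete_primitive_orthogonal_idempotents_def lattice_eq
proof (intro conjI ballI impI)
  let ?C = "carrier (face_algebra A \<nu>) :: ('v set \<Rightarrow> 'k) set"
  have C: "(face_algebra A \<nu>)\<lparr>carrier := ?C\<rparr> = face_algebra A \<nu>"
    by simp
  show "primitive_idempotent (face_algebra A \<nu>) (e X)" if "X \<in> L" for X
    using primitive_idempotentI[of "e X" ?C A \<nu>] e_closed[OF that] e_idem[OF that]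
      e_neq_0[OF that] e_conv_e_sandwich[OF that] unfolding C by blast
  show "e X \<otimes>\<^bsub>face_algebra A \<nu>\<^esub> e Y = \<zero>\<^bsub>face_algebra A \<nu>\<^esub>" if "X \<in> L" "Y \<in> L" "X \<noteq> Y" for X Y
    using e_orthogonal[OF that] by simp
  have "(\<Oplus>\<^bsub>face_algebra A \<nu>\<^esub>X\<in>L. e X) = (\<Sum>X\<in>L. e X)"
    using e_closed by (rule finsum_face_algebra_carrier)
  then show "(\<Oplus>\<^bsub>face_algebra A \<nu>\<^esub>X\<in>L. e X) = \<one>\<^bsub>face_algebra A \<nu>\<^esub>"
    by (simp add: e_sum)
qed (rule finite_L)

section \<open>Orbits on the intersection lattice\<close>

definition orbit_of :: "'v set \<Rightarrow> 'v set set" where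
  "orbit_of X = (\<lambda>w. w ` X) ` W"

lemma orbits_eq:
  "orbits (orthogonal_group\<lparr>carrier := W\<rparr>) (intersection_lattice A \<nu>) image = orbit_of ` L"
  by (auto simp: orbits_def orbit_def orbit_of_def lattice_eq)

lemma mem_orbit_of: "X \<in> orbit_of X"
  unfolding orbit_of_def using id_mem by (rule rev_image_eqI) simp

lemma image_orbit_of_subset:
  assumes w: "w \<in> W"
  shows "(`) w ` orbit_of X \<subseteq> orbit_of X"
proof
  fix Y assume "Y \<in> (`) w ` orbit_of X"
  then obtain v where v: "v \<in> W" "Y = w ` v ` X" by (auto simp: orbit_of_def)
  then have "Y = (w \<circ> v) ` X" by (simp add: image_comp)
  with comp_mem[OF w v(1)] show "Y \<in> orbit_of X"
    unfolding orbit_of_def by blast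
qed

lemma image_orbit_of:
  assumes w: "w \<in> W"
  shows "(`) w ` orbit_of X = orbit_of X"
proof
  obtain w' where w': "w' \<in> W" "\<And>v. w (w' v) = v"
    using inverseE[OF w] by metis
  have "(`) w ` (`) w' ` orbit_of X \<subseteq> (`) w ` orbit_of X"
    using image_orbit_of_subset[OF w'(1)] by (rule image_mono)
  then show "orbit_of X \<subseteq> (`) w ` orbit_of X"
    by (simp add: image_image w')
qed (rule image_orbit_of_subset[OF w])

lemma orbit_of_image:
  assumes w: "w \<in> W"
  shows "orbit_of (w ` X) = orbit_of X"
proof
  show "orbit_of (w ` X) \<subseteq> orbit_of X"
  proof
    fix Y assume "Y \<in> orbit_of (w ` X)"
    then obtain v where v: "v \<in> W" "Y = v ` w ` X" by (auto simp: orbit_of_def)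
    then have "Y = (v \<circ> w) ` X" by (simp add: image_comp)
    with comp_mem[OF v(1) w] show "Y \<in> orbit_of X"
      unfolding orbit_of_def by blast
  qed
  obtain w' where w': "w' \<in> W" "\<And>v. w' (w v) = v"
    using inverseE[OF w] by metis
  show "orbit_of X \<subseteq> orbit_of (w ` X)"
  proof
    fix Y assume "Y \<in> orbit_of X"
    then obtain v where v: "v \<in> W" "Y = v ` X" by (auto simp: orbit_of_def)
    then have "Y = (v \<circ> w') ` (w ` X)" by (simp add: image_image w')
    with comp_mem[OF v(1) w'(1)] show "Y \<in> orbit_of (w ` X)"
      unfolding orbit_of_def by blast
  qed
qed

lemma orbit_of_eq: "Y \<in> orbit_of X \<Longrightarrow> orbit_of Y = orbit_of X"
  by (auto simp: orbit_of_def[of X] orbit_of_image)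

lemma orbit_of_subset: "X \<in> L \<Longrightarrow> orbit_of X \<subseteq> L"
  using image_lattice by (auto simp: orbit_of_def)

text \<open>An inclusion between two members of an orbit is an equality because \<open>W\<close> preserves the number
  of lattice elements above a given one.\<close>

lemma orbit_antichain:
  assumes X: "X \<in> L" and Y: "Y \<in> orbit_of X" and le: "X \<subseteq> Y"
  shows "X = Y"
proof (rule ccontr)
  assume "X \<noteq> Y"
  obtain w where w: "w \<in> W" "Y = w ` X" using Y by (auto simp: orbit_of_def)
  have "Y \<in> {Z \<in> L. X \<subset> Z}"
    using orbit_of_subset[OF X] Y le \<open>X \<noteq> Y\<close> by auto
  then have "{Z \<in> L. Y \<subset> Z} \<subset> {Z \<in> L. X \<subset> Z}"
    by auto
  then have "card {Z \<in> L. Y \<subset> Z} < card {Z \<in> L. X \<subset> Z}"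
    by (intro psubset_card_mono) simp_all
  moreover have "card {Z \<in> L. Y \<subset> Z} = card {Z \<in> L. X \<subset> Z}"
    unfolding w(2) image_above[OF w(1)] by (rule card_image[OF inj_image[OF w(1)]])
  ultimately show False by simp
qed

section \<open>The invariant subalgebra\<close>

definition invariants :: "('v set \<Rightarrow> 'k) set" where
  "invariants = {a \<in> carrier (face_algebra A \<nu>). \<forall>w\<in>W. algebra_act w a = a}"

lemma invariant_algebra_eq:
  "invariant_algebra W A \<nu> = (face_algebra A \<nu>)\<lparr>carrier := invariants\<rparr>"
  by (simp add: invariant_algebra_def invariants_def)

lemma invariants_closed:
  "0 \<in> invariants" "a \<in> invariants \<Longrightarrow> b \<in> invariants \<Longrightarrow> a + b \<in> invariants"
  by (auto simp: invariants_def fun_apply algebra_act_add) (simp add: algebra_act_def fun_apply fun_eq_iff)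

definition eps :: "'v set set \<Rightarrow> 'v set \<Rightarrow> 'k" where
  "eps \<Omega> = (\<Sum>X\<in>\<Omega>. e X)"

lemma finite_orbit_of: "X \<in> L \<Longrightarrow> finite (orbit_of X)"
  by (rule finite_subset[OF orbit_of_subset finite_L])

lemma eps_invariant:
  assumes X: "X \<in> L"
  shows "eps (orbit_of X) \<in> invariants"
  unfolding invariants_def
proof (intro CollectI conjI ballI)
  show "eps (orbit_of X) \<in> carrier (face_algebra A \<nu>)"
    using orbit_of_subset[OF X] e_closed
    by (auto simp: eps_def fun_apply intro!: sum.neutral)
  fix w assume w: "w \<in> W"
  have "algebra_act w (eps (orbit_of X)) = (\<Sum>Y\<in>orbit_of X. e (w ` Y))"
    unfolding eps_def algebra_act_sum
    using orbit_of_subset[OF X] by (intro sum.cong refl e_equivariant[OF w]) blast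
  also have "\<dots> = (\<Sum>Y\<in>(`) w ` orbit_of X. e Y)"
    by (simp add: sum.reindex[OF inj_image[OF w]] o_def)
  finally show "algebra_act w (eps (orbit_of X)) = eps (orbit_of X)"
    by (simp add: image_orbit_of[OF w] eps_def)
qed

text \<open>Orthogonality leaves at most the term \<open>Z = Y\<close>. Both the products of orbit
  sums and their non-vanishing are read off from this.\<close>

lemma eps_conv_e:
  assumes X: "X \<in> L" and Y: "Y \<in> L"
  shows "eps (orbit_of X) \<star> e Y = (if Y \<in> orbit_of X then e Y else 0)"
proof -
  have "eps (orbit_of X) \<star> e Y = (\<Sum>Z\<in>orbit_of X. if Z = Y then e Y else 0)"
    unfolding eps_def conv_sum_left
  proof (intro sum.cong refl)
    fix Z assume "Z \<in> orbit_of X"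
    then have "Z \<in> L" using orbit_of_subset[OF X] by blast
    then show "e Z \<star> e Y = (if Z = Y then e Y else 0)"
      using e_idem e_orthogonal Y by simp
  qed
  then show ?thesis using finite_orbit_of[OF X] by simp
qed

lemma eps_conv_eps:
  assumes X: "X \<in> L" and Y: "Y \<in> L"
  shows "eps (orbit_of X) \<star> eps (orbit_of Y) = (if orbit_of X = orbit_of Y then eps (orbit_of X) else 0)"
proof -
  have "eps (orbit_of X) \<star> eps (orbit_of Y) = (\<Sum>Z\<in>orbit_of Y. eps (orbit_of X) \<star> e Z)"
    by (subst (2) eps_def) (rule conv_sum_right)
  also have "\<dots> = (\<Sum>Z\<in>orbit_of Y. if orbit_of X = orbit_of Y then e Z else 0)"
  proof (intro sum.cong refl)
    fix Z assume Z: "Z \<in> orbit_of Y"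
    \<comment> \<open>Orbits that meet coincide, so the condition on \<open>Z\<close> depends only
      on the two orbits.\<close>
    have "Z \<in> orbit_of X \<longleftrightarrow> orbit_of X = orbit_of Y"
      using Z orbit_of_eq[of Z X] orbit_of_eq[of Z Y] by auto
    moreover have "Z \<in> L" using Z orbit_of_subset[OF Y] by blast
    ultimately show "eps (orbit_of X) \<star> e Z = (if orbit_of X = orbit_of Y then e Z else 0)"
      using eps_conv_e[OF X] by (simp only:)
  qed
  also have "\<dots> = (if orbit_of X = orbit_of Y then eps (orbit_of X) else 0)"
    by (simp add: eps_def)
  finally show ?thesis .
qed

lemma eps_neq_0:
  assumes X: "X \<in> L"
  shows "eps (orbit_of X) \<noteq> 0"
proof
  assume "eps (orbit_of X) = 0"
  with eps_conv_e[OF X X] mem_orbit_of[of X] e_neq_0[OF X] show False by simp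
qed

text \<open>Reindexing by \<open>w\<close> leaves the coefficients unchanged because
  \<open>f\<close> is invariant, and it shifts the bound on the supports.\<close>

lemma sum_below_image:
  assumes w: "w \<in> W" and f: "f \<in> invariants"
  shows "(\<Sum>y\<in>{y \<in> faces A \<nu>. supp A y \<subseteq> w ` X}. f y) = (\<Sum>y\<in>{y \<in> faces A \<nu>. supp A y \<subseteq> X}. f y)"
proof -
  have f_image: "f (w ` y) = f y" for y
    using f algebra_act_image[OF w, of f y] w by (simp add: invariants_def)
  have "(\<Sum>y\<in>{y \<in> faces A \<nu>. supp A y \<subseteq> w ` X}. f y)
      = (\<Sum>y\<in>faces A \<nu>. if supp A y \<subseteq> w ` X then f y else 0)"
    by (simp add: sum.inter_filter)
  also have "\<dots> = (\<Sum>y\<in>faces A \<nu>. if supp A (w ` y) \<subseteq> w ` X then f (w ` y) else 0)"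
    by (rule sum.reindex_bij_betw[OF bij_faces[OF w], symmetric])
  also have "\<dots> = (\<Sum>y\<in>faces A \<nu>. if supp A y \<subseteq> X then f y else 0)"
    by (intro sum.cong refl)
      (simp add: f_image supp_image[OF w] inj_image_subset_iff[OF bij_is_inj[OF bij[OF w]]])
  finally show ?thesis
    by (simp add: sum.inter_filter)
qed

lemma eps_sandwich:
  assumes X: "X \<in> L" and f: "f \<in> invariants"
  shows "\<exists>c. eps (orbit_of X) \<star> (f \<star> eps (orbit_of X)) = (\<lambda>x. c * eps (orbit_of X) x)"
proof -
  \<comment> \<open>The scalar is taken at the representative \<open>X\<close>;
    \<open>sum_below_image\<close> transports it to the other members of the orbit.\<close>
  define c where "c = (\<Sum>y\<in>{y \<in> faces A \<nu>. supp A y \<subseteq> X}. f y)"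
  have "e Y \<star> (f \<star> e Z) = (if Z = Y then (\<lambda>x. c * e Y x) else 0)"
    if Y: "Y \<in> orbit_of X" and Z: "Z \<in> orbit_of X" for Y Z
  proof (cases "Z = Y")
    case True
    obtain w where "w \<in> W" "Y = w ` X" using Y by (auto simp: orbit_of_def)
    then have "(\<Sum>y\<in>{y \<in> faces A \<nu>. supp A y \<subseteq> Y}. f y) = c"
      using sum_below_image[OF _ f] by (simp add: c_def)
    with True e_conv_e_sandwich[of Y f] Y orbit_of_subset[OF X] show ?thesis by auto
  next
    case False
    have YZ: "Y \<in> L" "Z \<in> L" using Y Z orbit_of_subset[OF X] by auto
    have "Z \<in> orbit_of Y" using Z orbit_of_eq[OF Y] by simp
    with orbit_antichain[OF YZ(1)] False have "\<not> Y \<subseteq> Z" by blast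
    with e_conv_e_sandwich_not_le[OF YZ] False show ?thesis by simp
  qed
  then have "eps (orbit_of X) \<star> (f \<star> eps (orbit_of X))
      = (\<Sum>Z\<in>orbit_of X. \<Sum>Y\<in>orbit_of X. if Z = Y then (\<lambda>x. c * e Y x) else 0)"
    unfolding eps_def conv_sum_left conv_sum_right by (intro sum.cong refl)
  also have "\<dots> = (\<Sum>Y\<in>orbit_of X. (\<lambda>x. c * e Y x))"
    using finite_orbit_of[OF X] by simp
  also have "\<dots> = (\<lambda>x. c * eps (orbit_of X) x)"
    by (simp add: eps_def fun_eq_iff sum_fun_apply sum_distrib_left)
  finally show ?thesis by blast
qed

lemma sum_eps: "(\<Sum>\<Omega>\<in>orbit_of ` L. eps \<Omega>) = (\<Sum>X\<in>L. e X)"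
proof -
  have "\<Union> (orbit_of ` L) = L"
    using orbit_of_subset mem_orbit_of by blast
  moreover have "\<Omega> \<inter> \<Omega>' = {}"
    if "\<Omega> \<in> orbit_of ` L" "\<Omega>' \<in> orbit_of ` L" "\<Omega> \<noteq> \<Omega>'" for \<Omega> \<Omega>'
    using that orbit_of_eq by (metis disjoint_iff image_iff)
  ultimately show ?thesis
    using sum.Union_disjoint[of "orbit_of ` L" e] finite_orbit_of by (auto simp: eps_def)
qed

theorem complete_invariant_idempotents:
  "complete_primitive_orthogonal_idempotents (invariant_algebra W A \<nu>)
     (orbits (orthogonal_group\<lparr>carrier := W\<rparr>) (intersection_lattice A \<nu>) image)
     (\<lambda>\<Omega>. \<Oplus>\<^bsub>face_algebra A \<nu>\<^esub>X\<in>\<Omega>. e X)"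
  unfolding complete_primitive_orthogonal_idempotents_def orbits_eq invariant_algebra_eq
proof (intro conjI ballI impI)
  \<comment> \<open>The inner sums are formed in the full algebra, since a single \<open>e X\<close>
    need not be invariant. Only the outer sum takes place among the invariants.\<close>
  have eps: "(\<Oplus>\<^bsub>face_algebra A \<nu>\<^esub>X\<in>\<Omega>. e X) = eps \<Omega>" if "\<Omega> \<in> orbit_of ` L" for \<Omega>
    unfolding eps_def using that orbit_of_subset
    by (intro finsum_face_algebra_carrier e_closed) blast
  show "primitive_idempotent ((face_algebra A \<nu>)\<lparr>carrier := invariants\<rparr>) (\<Oplus>\<^bsub>face_algebra A \<nu>\<^esub>X\<in>\<Omega>. e X)"
    if \<Omega>: "\<Omega> \<in> orbit_of ` L" for \<Omega>
  proof -
    obtain X where X: "X \<in> L" "\<Omega> = orbit_of X" using \<Omega> by blast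
    show ?thesis
      unfolding eps[OF \<Omega>] unfolding X(2)
      by (intro primitive_idempotentI eps_invariant eps_neq_0 eps_sandwich X)
        (simp_all add: eps_conv_eps X)
  qed
  show "(\<Oplus>\<^bsub>face_algebra A \<nu>\<^esub>X\<in>\<Omega>. e X) \<otimes>\<^bsub>(face_algebra A \<nu>)\<lparr>carrier := invariants\<rparr>\<^esub>
      (\<Oplus>\<^bsub>face_algebra A \<nu>\<^esub>X\<in>\<Omega>'. e X) = \<zero>\<^bsub>(face_algebra A \<nu>)\<lparr>carrier := invariants\<rparr>\<^esub>"
    if \<Omega>: "\<Omega> \<in> orbit_of ` L" "\<Omega>' \<in> orbit_of ` L" "\<Omega> \<noteq> \<Omega>'" for \<Omega> \<Omega>'
  proof -
    obtain X Y where "X \<in> L" "\<Omega> = orbit_of X" "Y \<in> L" "\<Omega>' = orbit_of Y" using \<Omega> by blast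
    with eps_conv_eps[of X Y] \<Omega>(3) show ?thesis
      unfolding eps[OF \<Omega>(1)] eps[OF \<Omega>(2)] by simp
  qed
  have "(\<Oplus>\<^bsub>(face_algebra A \<nu>)\<lparr>carrier := invariants\<rparr>\<^esub>\<Omega>\<in>orbit_of ` L.
      \<Oplus>\<^bsub>face_algebra A \<nu>\<^esub>X\<in>\<Omega>. e X) = (\<Sum>\<Omega>\<in>orbit_of ` L. \<Oplus>\<^bsub>face_algebra A \<nu>\<^esub>X\<in>\<Omega>. e X)"
  proof (rule finsum_face_algebra)
    fix \<Omega> assume \<Omega>: "\<Omega> \<in> orbit_of ` L"
    with eps_invariant show "(\<Oplus>\<^bsub>face_algebra A \<nu>\<^esub>X\<in>\<Omega>. e X) \<in> invariants"
      unfolding eps[OF \<Omega>] by blast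
  qed (rule invariants_closed)+
  also have "\<dots> = (\<Sum>\<Omega>\<in>orbit_of ` L. eps \<Omega>)"
    by (intro sum.cong refl eps)
  finally show "(\<Oplus>\<^bsub>(face_algebra A \<nu>)\<lparr>carrier := invariants\<rparr>\<^esub>\<Omega>\<in>orbit_of ` L.
      \<Oplus>\<^bsub>face_algebra A \<nu>\<^esub>X\<in>\<Omega>. e X) = \<one>\<^bsub>(face_algebra A \<nu>)\<lparr>carrier := invariants\<rparr>\<^esub>"
    by (simp add: sum_eps e_sum)
qed simp

end

section \<open>Reflection groups\<close>

lemma reflection_involution:
  assumes "is_reflection r"
  shows "r \<circ> r = id"
proof -
  obtain a where "a \<noteq> 0" "r = (\<lambda>v. v - (2 * (a \<bullet> v) / (a \<bullet> a)) *\<^sub>R a)"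
    using assms by (auto simp: is_reflection_def)
  then show ?thesis
    by (simp add: fun_eq_iff inner_diff_right)
qed

lemma reflection_orthogonal:
  assumes "is_reflection r"
  shows "orthogonal_transformation r"
proof -
  obtain a where a: "a \<noteq> 0" "r = (\<lambda>v. v - (2 * (a \<bullet> v) / (a \<bullet> a)) *\<^sub>R a)"
    using assms by (auto simp: is_reflection_def)
  have "linear r"
    unfolding a(2) by (intro linearI) (simp_all add: inner_add_right algebra_simps add_divide_distrib)
  moreover have "r v \<bullet> r w = v \<bullet> w" for v w
  proof -
    \<comment> \<open>\<open>k v\<close> is the multiple of \<open>a\<close> subtracted from
      \<open>v\<close>. By \<open>k\<close> the quadratic term becomes
      \<open>2 * k v * (a \<bullet> w)\<close>, and the two linear terms are equal, so all three
      cancel.\<close>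
    define k where "k v = 2 * (a \<bullet> v) / (a \<bullet> a)" for v
    have k: "k w * (a \<bullet> a) = 2 * (a \<bullet> w)" "k w * (a \<bullet> v) = k v * (a \<bullet> w)"
      using a(1) by (simp_all add: k_def)
    have "r v \<bullet> r w = v \<bullet> w - k w * (a \<bullet> v) - k v * (a \<bullet> w) + k v * (k w * (a \<bullet> a))"
      unfolding a(2) k_def[symmetric]
      by (simp add: inner_diff_left inner_diff_right inner_commute[of v a] algebra_simps)
    then show ?thesis by (simp add: k)
  qed
  ultimately show ?thesis by (simp add: orthogonal_transformation_def)
qed

text \<open>The conjugate is the reflection along \<open>w a\<close>, because orthogonality turns
  \<open>a \<bullet> w' v\<close> into \<open>w a \<bullet> v\<close>.\<close>

lemma reflection_conjugate:
  assumes r: "is_reflection r" and w: "orthogonal_transformation w"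
    and w': "\<And>v. w (w' v) = v"
  shows "is_reflection (w \<circ> r \<circ> w')"
proof -
  obtain a where a: "a \<noteq> 0" "r = (\<lambda>v. v - (2 * (a \<bullet> v) / (a \<bullet> a)) *\<^sub>R a)"
    using r by (auto simp: is_reflection_def)
  have inner: "w x \<bullet> w y = x \<bullet> y" for x y
    using w by (simp add: orthogonal_transformation_def)
  have "w a \<noteq> 0"
    using inner[of a a] a(1) by auto
  moreover have "(w \<circ> r \<circ> w') v = v - (2 * (w a \<bullet> v) / (w a \<bullet> w a)) *\<^sub>R w a" for v
    using inner[of a "w' v"] w
    by (simp add: a(2) inner w' linear_diff linear_scale orthogonal_transformation_def)
  ultimately show ?thesis
    unfolding is_reflection_def by blast
qed

text \<open>\<open>generate\<close> also adjoins inverses of generators; for involutions these are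
  the generators again. The description behind \<open>m_inv\<close> is resolved by cancelling
  \<open>r\<close> in \<open>r \<circ> y\<close>.\<close>

lemma inv_involution:
  assumes "is_reflection r"
  shows "inv\<^bsub>orthogonal_group\<^esub> r = r"
  unfolding m_inv_def
proof (rule the_equality)
  show "r \<in> carrier orthogonal_group \<and> r \<otimes>\<^bsub>orthogonal_group\<^esub> r = \<one>\<^bsub>orthogonal_group\<^esub>
      \<and> r \<otimes>\<^bsub>orthogonal_group\<^esub> r = \<one>\<^bsub>orthogonal_group\<^esub>"
    using assms by (simp add: orthogonal_group_def reflection_involution reflection_orthogonal)
  fix y assume "y \<in> carrier orthogonal_group \<and> r \<otimes>\<^bsub>orthogonal_group\<^esub> y = \<one>\<^bsub>orthogonal_group\<^esub>
      \<and> y \<otimes>\<^bsub>orthogonal_group\<^esub> r = \<one>\<^bsub>orthogonal_group\<^esub>"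
  then have "r \<circ> (r \<circ> y) = r" by (simp add: orthogonal_group_def)
  then show "y = r"
    by (simp add: reflection_involution[OF assms] flip: comp_assoc)
qed

text \<open>The inverse must be found inside the generated set: reflections are their own inverses,
  and for a product the inverses are composed in reverse order.\<close>

lemma generate_reflections:
  fixes w :: "'a::real_inner \<Rightarrow> 'a"
  assumes S: "\<forall>r\<in>S. is_reflection r" and "w \<in> generate orthogonal_group S"
  shows "orthogonal_transformation w
    \<and> (\<exists>w'\<in>generate orthogonal_group S. w \<circ> w' = id \<and> w' \<circ> w = id)"
  using assms(2)
proof (induction rule: generate.induct)
  case one
  have id: "\<one>\<^bsub>orthogonal_group\<^esub> = (id :: 'a \<Rightarrow> 'a)"
    by (simp add: orthogonal_group_def)
  have "orthogonal_transformation (id :: 'a \<Rightarrow> 'a)"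
    by (simp add: orthogonal_transformation_def linear_id)
  then show ?case
    using generate.one[of orthogonal_group S] unfolding id by (intro conjI bexI[of _ id]) simp_all
next
  case (incl r)
  with S have "is_reflection r" by blast
  with generate.incl[OF incl] show ?case
    using reflection_orthogonal[of r] reflection_involution[of r] by blast
next
  case (inv r)
  with S have r: "is_reflection r" by blast
  with generate.incl[OF inv] show ?case
    unfolding inv_involution[OF r]
    using reflection_orthogonal[OF r] reflection_involution[OF r] r by blast
next
  case (eng g h)
  then obtain g' h' where
    g': "g' \<in> generate orthogonal_group S" "g \<circ> g' = id" "g' \<circ> g = id" and
    h': "h' \<in> generate orthogonal_group S" "h \<circ> h' = id" "h' \<circ> h = id"
    by blast
  have "h' \<circ> g' \<in> generate orthogonal_group S"
    using generate.eng[OF h'(1) g'(1)] by (simp add: orthogonal_group_def)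
  moreover have "(g \<circ> h) \<circ> (h' \<circ> g') = id" "(h' \<circ> g') \<circ> (g \<circ> h) = id"
    using g' h' by (simp_all add: fun_eq_iff)
  moreover have "orthogonal_transformation (g \<circ> h)"
    using eng by (intro orthogonal_transformation_compose) auto
  moreover have "g \<otimes>\<^bsub>orthogonal_group\<^esub> h = g \<circ> h"
    by (simp add: orthogonal_group_def)
  ultimately show ?case
    by (auto simp only: intro!: bexI[of _ "h' \<circ> g'"])
qed

text \<open>If \<open>H\<close> is the fixed space of \<open>r\<close>, its image under
  \<open>w\<close> is the fixed space of the conjugate of \<open>r\<close> by \<open>w\<close>,
  again a reflection in \<open>W\<close>. So \<open>W\<close> permutes its own arrangement.\<close>

lemma reflection_arrangement_symmetric:
  assumes W: "finite_reflection_group W"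
    and \<nu>: "half_space_labelling (reflection_arrangement W) \<nu>"
  shows "symmetric_arrangement (reflection_arrangement W) \<nu> W"
proof
  obtain S where S: "\<forall>r\<in>S. is_reflection r" and W_eq: "W = generate orthogonal_group S"
    using W by (auto simp: finite_reflection_group_def)
  have "reflection_arrangement W \<subseteq> (\<lambda>r. {v. r v = v}) ` W"
    by (auto simp: reflection_arrangement_def)
  then show "finite (reflection_arrangement W)"
    using W by (meson finite_reflection_group_def finite_surj)
  show "half_space_labelling (reflection_arrangement W) \<nu>" by fact
  show "id \<in> W"
    using generate.one[of orthogonal_group S] by (simp add: orthogonal_group_def W_eq)
  show comp: "w \<circ> w' \<in> W" if "w \<in> W" "w' \<in> W" for w w'
    using generate.eng[of w orthogonal_group S w'] that by (simp add: orthogonal_group_def W_eq)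
  show orth: "orthogonal_transformation w" if "w \<in> W" for w
    using generate_reflections[OF S] that by (simp add: W_eq)
  show inverse: "\<exists>w'\<in>W. w \<circ> w' = id \<and> w' \<circ> w = id" if "w \<in> W" for w
    using generate_reflections[OF S] that by (simp add: W_eq)
  fix w H assume w: "w \<in> W" and "H \<in> reflection_arrangement W"
  then obtain r where r: "r \<in> W" "is_reflection r" "H = {v. r v = v}"
    by (auto simp: reflection_arrangement_def)
  obtain w' where "w' \<in> W" "w \<circ> w' = id" "w' \<circ> w = id" using inverse[OF w] by blast
  then have w': "w' \<in> W" "\<And>v. w (w' v) = v" "\<And>v. w' (w v) = v"
    by (simp_all add: pointfree_idE)
  have "w ` H = {v. (w \<circ> r \<circ> w') v = v}"
  proof (intro equalityI subsetI)
    fix v assume "v \<in> {v. (w \<circ> r \<circ> w') v = v}"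
    then have "w (r (w' v)) = v" by simp
    then have "r (w' v) = w' v" using w'(3)[of "r (w' v)"] by simp
    then show "v \<in> w ` H" by (intro image_eqI[of _ _ "w' v"]) (simp_all add: w' r(3))
  qed (auto simp: r(3) w')
  moreover have "is_reflection (w \<circ> r \<circ> w')"
    using r(2) orth[OF w] w'(2) by (rule reflection_conjugate)
  moreover have "w \<circ> r \<circ> w' \<in> W"
    by (intro comp w r w')
  ultimately show "w ` H \<in> reflection_arrangement W"
    unfolding reflection_arrangement_def by blast
qed

theorem theorem5p2:
  fixes W :: "('v::real_inner \<Rightarrow> 'v) set"
    and A :: "'v set set"
    and \<nu> :: "'v set \<Rightarrow> 'v"
    and l :: "'v set \<Rightarrow> 'v set \<Rightarrow> 'k::field"
  assumes "\<exists>B::'v set. finite B \<and> span B = UNIV"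
    and "finite_reflection_group W"
    and "\<not> CHAR('k) dvd card W"
    and "A = reflection_arrangement W"
    and "half_space_labelling A \<nu>"
    and "\<forall>X\<in>intersection_lattice A \<nu>. support_section A \<nu> X (l X)"
    and "\<forall>w\<in>W. \<forall>X\<in>intersection_lattice A \<nu>. algebra_act w (l X) = l (w ` X)"
  shows "complete_primitive_orthogonal_idempotents (face_algebra A \<nu>)
           (intersection_lattice A \<nu>) (face_idempotent A \<nu> l)
         \<and> (\<forall>w\<in>W. \<forall>X\<in>intersection_lattice A \<nu>.
              algebra_act w (face_idempotent A \<nu> l X) = face_idempotent A \<nu> l (w ` X))
         \<and> complete_primitive_orthogonal_idempotents (invariant_algebra W A \<nu>)
             (orbits (orthogonal_group\<lparr>carrier := W\<rparr>) (intersection_lattice A \<nu>) image)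
             (\<lambda>\<Omega>. \<Oplus>\<^bsub>face_algebra A \<nu>\<^esub>X\<in>\<Omega>. face_idempotent A \<nu> l X)"
proof -
  interpret equivariant_sections A \<nu> W l
  proof (intro equivariant_sections.intro equivariant_sections_axioms.intro)
    show "symmetric_arrangement A \<nu> W"
      using reflection_arrangement_symmetric assms(2,4,5) by blast
    show "support_section A \<nu> X (l X)" if "X \<in> intersection_lattice A \<nu>" for X
      using assms(6) that by (rule bspec)
    show "algebra_act w (l X) = l (w ` X)" if "w \<in> W" "X \<in> intersection_lattice A \<nu>" for w X
      using assms(7) that by blast
  qed
  show ?thesis
    using complete_idempotents e_equivariant complete_invariant_idempotents
    by (simp add: lattice_eq)
qed

end
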